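(* Let $\mathbb F$ be a field of characteristic $0$ and let $\mathcal Vir^c$ be the Virasoro PVA of central charge $c$. For every $c\in\mathbb F$: (a) Every Casimir element of the PVA $\mathcal Vir^c$ is a scalar multiple of $\int1$. (b) Every derivation of the PVA $\mathcal Vir^c$ is inner. (c) Up to equivalence, any first-order deformation of $\mathcal Vir^c$ which preserves the product and the $\mathbb F[\partial]$-module structure corresponds to a scalar multiple of the $2$-cocycle given by $Y_{\lambda_1,\lambda_2}(L\otimes L)=\lambda_1^3+\langle\partial+\lambda_1+\lambda_2\rangle$.
   Context: $\mathbb F$ is a field of characteristic $0$. Everything here is purely even. $\int:\mathcal V\to\mathcal V/\partial\mathcal V$ is the quotient map. PVA: a Poisson vertex algebra is a commutative associative unital algebra $\mathcal V$ with a derivation $\partial$ and a bilinear map $\mathcal V\otimes\mathcal V\to\mathcal V[\lambda]$, $a\otimes b\mapsto[a_\lambda b]$, with $[\partial a_\lambda b]=-\lambda[a_\lambda b]$, $[a_\lambda\partial b]=(\lambda+\partial)[a_\lambda b]$, $[a_\lambda b]=-[b_{-\lambda-\partial}a]$ ($\partial$ acting from the left on coefficients), $[a_\lambda[b_\mu c]]-[b_\mu[a_\lambda c]]=[[a_\lambda b]_{\lambda+\mu}c]$, $[a_\lambda bc]=[a_\lambda b]c+[a_\lambda c]b$. A Casimir element of $\mathcal V$ is $\int a\in\mathcal V/\partial\mathcal V$ with $[a_\lambda\mathcal V]|_{\lambda=0}=0$. A derivation of $\mathcal V$ is a linear map $D:\mathcal V\to\mathcal V$ commuting with $\partial$ which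 is a derivation of the product and satisfies $D[a_\lambda b]=[(Da)_\lambda b]+[a_\lambda(Db)]$. It is inner if $D=[a_\lambda\,\cdot\,]|_{\lambda=0}$ for some $a\in\mathcal V$. A first-order deformation preserving the product and the $\mathbb F[\partial]$-module structure is a PVA structure over $\mathbb F[\epsilon]/(\epsilon^2)$ on $\mathcal V\otimes\mathbb F[\epsilon]/(\epsilon^2)$ with product and $\partial$ extended $\epsilon$-linearly and $\lambda$-bracket $[a_\lambda b]+\epsilon\{a_\lambda b\}$, $a,b\in\mathcal V$. Two such are equivalent if related by an automorphism $\mathrm{id}+\epsilon D$, $D$ a derivation of the product of $\mathcal V$ commuting with $\partial$. The deformation corresponds to the variational PVA $2$-cocycle $Y:\mathcal V^{\otimes2}\to\mathcal V[\lambda_1,\lambda_2]/\langle\partial+\lambda_1+\lambda_2\rangle$ ($\langle\Phi\rangle$ = image of $\Phi$) with $\{a_\lambda b\}=Y_{\lambda,-\lambda-\partial}(a\otimes b)$, which by sesquilinearity and the Leibniz rules is determined by its value on $L\otimes L$; thus the cocycle in (c) corresponds to $\{L_\lambda L\}=\lambda^3\,1$. Virasoro PVA: $\mathcal Vir^c=\mathbb F[L^{(n)}\mid n\ge0]$, $L^{(n)}=\partial^nL$, polynomial algebra with the unique PVA $\lambda$-bracket such that $[L_\lambda L]=(\partial+2\lambda)L+\frac c{12}\lambda^3$. *)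

theory Defs
  imports "HOL-Computational_Algebra.Polynomial" "HOL-Library.Poly_Mapping"
begin

section \<open>Poisson vertex algebras over a commutative ring\<close>

text \<open>Elements of \<open>V[\<lambda>]\<close> are univariate polynomials with coefficients in \<open>V\<close>, and \<open>br a b\<close>
  stands for \<open>[a\<^sub>\<lambda> b]\<close>. An additive operator on \<open>V\<close> acts on \<open>V[\<lambda>]\<close> coefficientwise, by
  \<^const>\<open>map_poly\<close>. Multiplication by \<open>\<lambda>\<close> is \<^term>\<open>pCons 0\<close>.\<close>

text \<open>\<open>subst_skew der p\<close> is \<open>p\<close> with \<open>\<lambda>\<close> replaced by \<open>-\<lambda>-\<partial>\<close>, the powers of \<open>-\<lambda>-\<partial>\<close> being
  written to the left of the coefficients of \<open>p\<close> and acting on them.\<close>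

definition subst_skew :: "('v::comm_ring_1 \<Rightarrow> 'v) \<Rightarrow> 'v poly \<Rightarrow> 'v poly" where
  "subst_skew der p =
     (\<Sum>j\<le>degree p. ((\<lambda>q. - pCons 0 q - map_poly der q) ^^ j) [:coeff p j:])"

text \<open>Elements of \<open>V[\<lambda>,\<mu>]\<close> are polynomials in \<open>\<mu>\<close> with coefficients in \<open>V[\<lambda>]\<close>.\<close>

definition pva_lam :: "'v::comm_ring_1 poly poly" where "pva_lam = [:[:0, 1:]:]"
definition pva_mu :: "'v::comm_ring_1 poly poly" where "pva_mu = [:0, 1:]"

definition subst2 :: "'v::comm_ring_1 poly \<Rightarrow> 'v poly poly \<Rightarrow> 'v poly poly" where
  "subst2 p x = (\<Sum>k\<le>degree p. [:[:coeff p k:]:] * x ^ k)"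

definition alg_derivation :: "('r::comm_ring_1 \<Rightarrow> 'v::comm_ring_1 \<Rightarrow> 'v) \<Rightarrow> ('v \<Rightarrow> 'v) \<Rightarrow> bool" where
  "alg_derivation scale D \<longleftrightarrow>
     module_hom scale scale D \<and> (\<forall>a b. D (a * b) = D a * b + a * D b)"

locale pva = module scale
  for scale :: "'r::comm_ring_1 \<Rightarrow> 'v::comm_ring_1 \<Rightarrow> 'v" +
  fixes der :: "'v \<Rightarrow> 'v"
    and br :: "'v \<Rightarrow> 'v \<Rightarrow> 'v poly"
  assumes scale_mult: "scale r (a * b) = scale r a * b"
    and der: "alg_derivation scale der"
    and br_add_left: "br (a + b) c = br a c + br b c"
    and br_add_right: "br a (b + c) = br a b + br a c"
    and br_scale_left: "br (scale r a) b = map_poly (scale r) (br a b)"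
    and br_scale_right: "br a (scale r b) = map_poly (scale r) (br a b)"
    and sesquilinear_left: "br (der a) b = - pCons 0 (br a b)"
    and sesquilinear_right: "br a (der b) = pCons 0 (br a b) + map_poly der (br a b)"
    and skew_symmetry: "br a b = - subst_skew der (br b a)"
    and jacobi:
      "(\<Sum>j\<le>degree (br b c). pva_mu ^ j * subst2 (br a (coeff (br b c) j)) pva_lam)
       - (\<Sum>i\<le>degree (br a c). pva_lam ^ i * subst2 (br b (coeff (br a c) i)) pva_mu)
       = (\<Sum>i\<le>degree (br a b). pva_lam ^ i * subst2 (br (coeff (br a b) i) c) (pva_lam + pva_mu))"
    and leibniz: "br a (b * c) = smult c (br a b) + smult b (br a c)"

text \<open>The class \<open>\<integral>a\<close> of \<open>a\<close> in the quotient \<open>V/\<partial>V\<close>, as a coset.\<close>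

definition loc_func :: "('v::comm_ring_1 \<Rightarrow> 'v) \<Rightarrow> 'v \<Rightarrow> 'v set" where
  "loc_func der a = {a + der v | v. True}"

definition casimir :: "('v::comm_ring_1 \<Rightarrow> 'v) \<Rightarrow> ('v \<Rightarrow> 'v \<Rightarrow> 'v poly) \<Rightarrow> 'v set \<Rightarrow> bool" where
  "casimir der br X \<longleftrightarrow> (\<exists>a. X = loc_func der a \<and> (\<forall>b. poly (br a b) 0 = 0))"

definition pva_derivation ::
  "('r::comm_ring_1 \<Rightarrow> 'v::comm_ring_1 \<Rightarrow> 'v) \<Rightarrow> ('v \<Rightarrow> 'v) \<Rightarrow> ('v \<Rightarrow> 'v \<Rightarrow> 'v poly) \<Rightarrow>
     ('v \<Rightarrow> 'v) \<Rightarrow> bool" where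
  "pva_derivation scale der br D \<longleftrightarrow>
     alg_derivation scale D \<and> (\<forall>a. D (der a) = der (D a)) \<and>
     (\<forall>a b. map_poly D (br a b) = br (D a) b + br a (D b))"

definition inner_derivation :: "('v::comm_ring_1 \<Rightarrow> 'v \<Rightarrow> 'v poly) \<Rightarrow> ('v \<Rightarrow> 'v) \<Rightarrow> bool" where
  "inner_derivation br D \<longleftrightarrow> (\<exists>a. \<forall>b. D b = poly (br a b) 0)"


section \<open>Dual numbers and first-order deformations\<close>

text \<open>\<open>Dual a b\<close> is \<open>a + \<epsilon> b\<close> with \<open>\<epsilon>\<^sup>2 = 0\<close>. Over a field \<open>F\<close> the type \<open>F dual\<close> is \<open>F[\<epsilon>]/(\<epsilon>\<^sup>2)\<close>,
  and for an \<open>F\<close>-algebra \<open>V\<close> the type \<open>V dual\<close> is \<open>V \<otimes> F[\<epsilon>]/(\<epsilon>\<^sup>2)\<close>.\<close>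

datatype 'a dual = Dual (std: 'a) (eps: 'a)

instantiation dual :: (comm_ring_1) comm_ring_1
begin

definition zero_dual_def: "0 = Dual 0 0"
definition one_dual_def: "1 = Dual 1 0"
definition plus_dual_def: "x + y = Dual (std x + std y) (eps x + eps y)"
definition minus_dual_def: "x - y = Dual (std x - std y) (eps x - eps y)"
definition uminus_dual_def: "- x = Dual (- std x) (- eps x)"
definition times_dual_def: "x * y = Dual (std x * std y) (std x * eps y + eps x * std y)"

instance
  by standard
    (auto simp: zero_dual_def one_dual_def plus_dual_def minus_dual_def uminus_dual_def
      times_dual_def algebra_simps dual.expand)

end

definition dual_scale ::
  "('r::comm_ring_1 \<Rightarrow> 'v::comm_ring_1 \<Rightarrow> 'v) \<Rightarrow> 'r dual \<Rightarrow> 'v dual \<Rightarrow> 'v dual" where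
  "dual_scale scale r x =
     Dual (scale (std r) (std x)) (scale (std r) (eps x) + scale (eps r) (std x))"

definition dual_der :: "('v::comm_ring_1 \<Rightarrow> 'v) \<Rightarrow> 'v dual \<Rightarrow> 'v dual" where
  "dual_der der x = Dual (der (std x)) (der (eps x))"

text \<open>The \<open>\<epsilon>\<close>-bilinear extension of \<open>[a\<^sub>\<lambda> b] + \<epsilon> {a\<^sub>\<lambda> b}\<close>, where \<open>br\<close> is \<open>[\<cdot>\<^sub>\<lambda> \<cdot>]\<close> and \<open>Z\<close> is
  \<open>{\<cdot>\<^sub>\<lambda> \<cdot>}\<close>.\<close>

definition dual_br ::
  "('v::comm_ring_1 \<Rightarrow> 'v \<Rightarrow> 'v poly) \<Rightarrow> ('v \<Rightarrow> 'v \<Rightarrow> 'v poly) \<Rightarrow>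
     'v dual \<Rightarrow> 'v dual \<Rightarrow> 'v dual poly" where
  "dual_br br Z x y =
     map_poly (\<lambda>v. Dual v 0) (br (std x) (std y)) +
     map_poly (\<lambda>v. Dual 0 v)
       (Z (std x) (std y) + br (eps x) (std y) + br (std x) (eps y))"

definition first_order_deformation ::
  "('r::comm_ring_1 \<Rightarrow> 'v::comm_ring_1 \<Rightarrow> 'v) \<Rightarrow> ('v \<Rightarrow> 'v) \<Rightarrow> ('v \<Rightarrow> 'v \<Rightarrow> 'v poly) \<Rightarrow>
     ('v \<Rightarrow> 'v \<Rightarrow> 'v poly) \<Rightarrow> bool" where
  "first_order_deformation scale der br Z \<longleftrightarrow>
     pva (dual_scale scale) (dual_der der) (dual_br br Z)"

definition id_plus_eps :: "('v::comm_ring_1 \<Rightarrow> 'v) \<Rightarrow> 'v dual \<Rightarrow> 'v dual" where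
  "id_plus_eps D x = Dual (std x) (eps x + D (std x))"

definition equivalent_deformations ::
  "('r::comm_ring_1 \<Rightarrow> 'v::comm_ring_1 \<Rightarrow> 'v) \<Rightarrow> ('v \<Rightarrow> 'v) \<Rightarrow> ('v \<Rightarrow> 'v \<Rightarrow> 'v poly) \<Rightarrow>
     ('v \<Rightarrow> 'v \<Rightarrow> 'v poly) \<Rightarrow> ('v \<Rightarrow> 'v \<Rightarrow> 'v poly) \<Rightarrow> bool" where
  "equivalent_deformations scale der br Z Z' \<longleftrightarrow>
     (\<exists>D. alg_derivation scale D \<and> (\<forall>a. D (der a) = der (D a)) \<and>
       (\<forall>x y. map_poly (id_plus_eps D) (dual_br br Z x y) =
              dual_br br Z' (id_plus_eps D x) (id_plus_eps D y)))"


section \<open>The Virasoro Poisson vertex algebra\<close>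

text \<open>Polynomials in the variables \<open>L\<^sup>(\<^sup>n\<^sup>)\<close>, \<open>n \<ge> 0\<close>: finitely supported functions from exponent
  vectors to coefficients.\<close>

type_synonym 'a vir = "(nat \<Rightarrow>\<^sub>0 nat) \<Rightarrow>\<^sub>0 'a"

definition vir_const :: "'a::field_char_0 \<Rightarrow> 'a vir" where
  "vir_const k = Poly_Mapping.single 0 k"

definition vir_scale :: "'a::field_char_0 \<Rightarrow> 'a vir \<Rightarrow> 'a vir" where
  "vir_scale k f = vir_const k * f"

definition vir_L :: "nat \<Rightarrow> 'a::field_char_0 vir" where
  "vir_L n = Poly_Mapping.single (Poly_Mapping.single n 1) 1"

text \<open>The derivation with \<open>\<partial>L\<^sup>(\<^sup>n\<^sup>) = L\<^sup>(\<^sup>n\<^sup>+\<^sup>1\<^sup>)\<close>: in a monomial \<open>m\<close>, each variable \<open>L\<^sup>(\<^sup>n\<^sup>)\<close> of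
  exponent \<open>m\<^sub>n\<close> contributes \<open>m\<^sub>n\<close> times the monomial with one factor \<open>L\<^sup>(\<^sup>n\<^sup>)\<close> replaced by
  \<open>L\<^sup>(\<^sup>n\<^sup>+\<^sup>1\<^sup>)\<close>.\<close>

definition vir_der :: "'a::field_char_0 vir \<Rightarrow> 'a vir" where
  "vir_der f =
     (\<Sum>m\<in>Poly_Mapping.keys f. \<Sum>n\<in>Poly_Mapping.keys m.
        Poly_Mapping.single (m - Poly_Mapping.single n 1 + Poly_Mapping.single (Suc n) 1)
          (of_nat (Poly_Mapping.lookup m n) * Poly_Mapping.lookup f m))"

text \<open>The coefficients below are those of \<open>(\<partial> + 2\<lambda>)L + (c/12)\<lambda>\<^sup>3\<close>.\<close>

definition vir_bracket :: "'a::field_char_0 \<Rightarrow> 'a vir \<Rightarrow> 'a vir \<Rightarrow> 'a vir poly" where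
  "vir_bracket c =
     (THE br. pva vir_scale vir_der br \<and>
        br (vir_L 0) (vir_L 0) = [:vir_L 1, 2 * vir_L 0, 0, vir_const (c / 12):])"

end

theory Submission
  imports Defs
begin

text \<open>An element of \<open>V[\<lambda>]\<close> is read as the symbol of a differential operator over \<open>V\<close>, so that
  \<open>\<lambda> \<mapsto> - \<lambda> - \<partial>\<close> becomes the formal adjoint and the Virasoro bracket of \<open>a\<close> and \<open>b\<close> is the
  operator product of the Frechet derivative of \<open>b\<close>, \<open>H = L' + 2L\<partial> + (c/12)\<partial>\<^sup>3\<close>, and the adjoint of
  the Frechet derivative of \<open>a\<close>. Skew-symmetry is \<open>H\<^sup>* = - H\<close>; the Jacobi identity propagates from
  \<open>(L, L, L)\<close>.

  (a) \<open>[a\<^sub>\<lambda> L]\<close> at \<open>\<lambda> = 0\<close> is \<open>H(\<delta>a/\<delta>L)\<close>. The operator \<open>H\<close> is injective, because the component \<open>f\<close>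
  of top polynomial degree of an element of its kernel satisfies \<open>\<partial>(L f\<^sup>2) = 0\<close>; and \<open>\<delta>a/\<delta>L = 0\<close>
  forces \<open>a\<close> to be a constant plus a total derivative.

  (b) The modes \<open>0\<close> and \<open>1\<close> of \<open>[L\<^sub>\<lambda> \<cdot>]\<close> are \<open>\<partial>\<close> and the conformal weight operator. A derivation \<open>D\<close>
  commutes with \<open>\<partial>\<close>, so \<open>DL\<close> is a Casimir element, \<open>DL = k + \<partial>g\<close> by (a). Mode \<open>1\<close> then exhibits
  the part of \<open>D\<close> shifting the weight by \<open>w\<close> as \<open>1/w\<close> times an inner derivation, and the part with
  \<open>w = 0\<close> vanishes.

  (c) The \<open>\<lambda>\<^sup>0\<close>-coefficient of a cocycle at \<open>L\<close> is a derivation, hence inner by (b), and it is removed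
  by a coboundary. The \<open>\<lambda>\<^sup>1\<close>-coefficient then contracts the cocycle onto its part of weight
  \<open>0\<close>, where \<open>{L\<^sub>\<lambda> L}\<close> is a combination of \<open>L' + 2\<lambda>L\<close> and \<open>\<lambda>\<^sup>3\<close>; rescaling \<open>L\<close> removes
  the former.\<close>

section \<open>Symbols of differential operators\<close>

lemma additiveI: "(\<And>x y. f (x + y) = f x + f y) \<Longrightarrow> additive f"
  by (simp add: additive_def)

lemma coeff_map_poly_additive: "additive f \<Longrightarrow> coeff (map_poly f p) n = f (coeff p n)"
  by (simp add: coeff_map_poly additive.zero)

lemma map_poly_additive_pCons:
  "additive f \<Longrightarrow> map_poly f (pCons a p) = pCons (f a) (map_poly f p)"
  by (simp add: map_poly_pCons additive.zero)

lemma additive_map_poly: "additive f \<Longrightarrow> additive (map_poly f)"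
  by (intro additiveI poly_eqI) (simp add: coeff_map_poly_additive additive.add)

lemmas map_poly_add = additive.add[OF additive_map_poly]
lemmas map_poly_minus = additive.minus[OF additive_map_poly]
lemmas map_poly_diff = additive.diff[OF additive_map_poly]

lemma map_poly_comp_additive:
  "additive f \<Longrightarrow> additive g \<Longrightarrow> map_poly f (map_poly g p) = map_poly (\<lambda>x. f (g x)) p"
  by (intro poly_eqI) (simp add: coeff_map_poly additive.zero)

text \<open>Left multiplication by \<open>\<lambda> + d\<close>: composition with \<open>d\<close>
  from the left when \<open>q\<close> is read as the symbol of an operator.\<close>

definition theta :: "('v::comm_ring_1 \<Rightarrow> 'v) \<Rightarrow> 'v poly \<Rightarrow> 'v poly" where
  "theta d q = pCons 0 q + map_poly d q"

lemma theta_0: "additive d \<Longrightarrow> theta d 0 = 0"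
  by (simp add: theta_def)

lemma theta_add: "additive d \<Longrightarrow> theta d (p + q) = theta d p + theta d q"
  by (simp add: theta_def map_poly_add)

lemma additive_theta: "additive d \<Longrightarrow> additive (theta d)"
  by (rule additiveI) (rule theta_add)

lemmas theta_diff = additive.diff[OF additive_theta]

lemma coeff_theta:
  "additive d \<Longrightarrow> coeff (theta d q) n = (case n of 0 \<Rightarrow> 0 | Suc k \<Rightarrow> coeff q k) + d (coeff q n)"
  by (simp add: theta_def coeff_map_poly_additive coeff_pCons)

lemma subst_skew_bound:
  assumes d: "additive d" and n: "degree p \<le> n"
  shows "subst_skew d p = (\<Sum>j\<le>n. ((\<lambda>q. - theta d q) ^^ j) [:coeff p j:])"
proof -
  have eq: "(\<lambda>q. - pCons 0 q - map_poly d q) = (\<lambda>q. - theta d q)"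
    by (simp add: theta_def fun_eq_iff)
  have z: "((\<lambda>q. - theta d q) ^^ j) 0 = 0" for j
    by (induction j) (simp_all add: theta_0[OF d])
  show ?thesis
    unfolding subst_skew_def eq
    by (rule sum.mono_neutral_left) (use n z in \<open>auto simp: coeff_eq_0\<close>)
qed

lemma subst_skew_0: "additive d \<Longrightarrow> subst_skew d 0 = 0"
  by (simp add: subst_skew_def)

text \<open>Horner's recursion for the substitution. The later facts about \<open>subst_skew\<close>
  are inductions along it rather than computations with the defining sum.\<close>

lemma subst_skew_pCons:
  assumes d: "additive d"
  shows "subst_skew d (pCons a p) = [:a:] - theta d (subst_skew d p)"
proof -
  have "additive (\<lambda>q. - theta d q)"
    by (intro additiveI) (simp add: theta_add[OF d])
  note s = additive.sum[OF this]
  have "subst_skew d (pCons a p) =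
      (\<Sum>j\<le>Suc (degree p). ((\<lambda>q. - theta d q) ^^ j) [:coeff (pCons a p) j:])"
    by (rule subst_skew_bound[OF d]) (rule degree_pCons_le)
  also have "\<dots> = [:a:] - theta d (subst_skew d p)"
    by (simp add: sum.atMost_Suc_shift subst_skew_bound[OF d order_refl] s del: sum.atMost_Suc)
  finally show ?thesis .
qed

lemma subst_skew_add:
  assumes d: "additive d"
  shows "subst_skew d (p + q) = subst_skew d p + subst_skew d q"
  by (induction p q rule: poly_induct2)
    (simp_all add: subst_skew_0[OF d] subst_skew_pCons[OF d] theta_add[OF d])

lemma additive_subst_skew: "additive d \<Longrightarrow> additive (subst_skew d)"
  by (rule additiveI) (rule subst_skew_add)

lemmas subst_skew_minus = additive.minus[OF additive_subst_skew]
lemmas subst_skew_diff = additive.diff[OF additive_subst_skew]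

lemma subst_skew_const: "additive d \<Longrightarrow> subst_skew d [:a:] = [:a:]"
  by (simp add: subst_skew_pCons subst_skew_0 theta_0)

lemma subst_skew_pCons_0: "additive d \<Longrightarrow> subst_skew d (pCons 0 p) = - theta d (subst_skew d p)"
  by (simp add: subst_skew_pCons)

lemma map_poly_theta:
  assumes f: "additive f" and d: "additive d" "additive e" and c: "\<And>x. f (d x) = e (f x)"
  shows "map_poly f (theta d p) = theta e (map_poly f p)"
  by (simp add: theta_def map_poly_add f d c map_poly_additive_pCons additive.zero
      map_poly_comp_additive)

text \<open>Source and target may carry different derivations: later \<open>f\<close> is a component
  projection of dual numbers, or a bracket that intertwines \<open>\<partial>\<close> with
  \<open>\<partial> + s\<close>.\<close>

lemma map_poly_subst_skew:
  assumes f: "additive f" and d: "additive d" "additive e" and c: "\<And>x. f (d x) = e (f x)"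
  shows "map_poly f (subst_skew d p) = subst_skew e (map_poly f p)"
  by (induction p)
    (simp_all add: subst_skew_0 subst_skew_pCons d map_poly_additive_pCons f map_poly_diff
      map_poly_theta[OF f d c])

text \<open>The substitution sends \<open>\<lambda> + \<partial>\<close> to
  \<open>-\<lambda>\<close>; this is what makes it an involution.\<close>

lemma subst_skew_theta:
  assumes d: "additive d"
  shows "subst_skew d (theta d p) = - pCons 0 (subst_skew d p)"
  by (simp add: theta_def[of d p] subst_skew_add[OF d] subst_skew_pCons_0[OF d]
      map_poly_subst_skew[OF d d d refl, symmetric]) (simp add: theta_def)

lemma subst_skew_involution:
  assumes d: "additive d"
  shows "subst_skew d (subst_skew d p) = p"
  by (induction p)
    (simp_all add: subst_skew_0 subst_skew_pCons subst_skew_diff subst_skew_const subst_skew_theta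
      theta_0 d)

text \<open>The symbol of a composite operator: composing with \<open>\<partial>\<close> from the
  left acts on symbols as \<open>\<lambda> + \<partial>\<close>.\<close>

definition star :: "('v::comm_ring_1 \<Rightarrow> 'v) \<Rightarrow> 'v poly \<Rightarrow> 'v poly \<Rightarrow> 'v poly" where
  "star d p q = (\<Sum>j\<le>degree p. smult (coeff p j) ((theta d ^^ j) q))"

lemma star_bound:
  "degree p \<le> n \<Longrightarrow> star d p q = (\<Sum>j\<le>n. smult (coeff p j) ((theta d ^^ j) q))"
  unfolding star_def by (rule sum.mono_neutral_left) (auto simp: coeff_eq_0)

lemma star_0_left [simp]: "star d 0 q = 0"
  by (simp add: star_def)

lemma star_pCons: "star d (pCons a p) q = smult a q + star d p (theta d q)"
proof -
  have "star d (pCons a p) q =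
      (\<Sum>j\<le>Suc (degree p). smult (coeff (pCons a p) j) ((theta d ^^ j) q))"
    by (rule star_bound) (rule degree_pCons_le)
  then show ?thesis
    by (simp add: sum.atMost_Suc_shift star_def funpow_swap1 del: sum.atMost_Suc)
qed

lemma star_add_left: "star d (p + p') q = star d p q + star d p' q"
  by (induction p p' arbitrary: q rule: poly_induct2) (simp_all add: star_pCons smult_add_left)

lemma star_add_right: "additive d \<Longrightarrow> star d p (q + q') = star d p q + star d p q'"
  by (induction p arbitrary: q q') (simp_all add: star_pCons smult_add_right theta_add)

lemma star_minus_left: "star d (- p) q = - star d p q"
  using star_add_left[of d p "- p" q] by (simp add: eq_neg_iff_add_eq_0 add.commute)

lemma star_minus_right: "additive d \<Longrightarrow> star d p (- q) = - star d p q"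
  using additive.minus[OF additiveI[of "star d p"]] star_add_right by blast

lemma star_diff_left: "star d (p - p') q = star d p q - star d p' q"
  using star_add_left[of d p "- p'" q] by (simp add: star_minus_left)

lemma star_diff_right: "additive d \<Longrightarrow> star d p (q - q') = star d p q - star d p q'"
  using additive.diff[OF additiveI[of "star d p"]] star_add_right by blast

lemma star_const: "star d [:a:] q = smult a q"
  by (simp add: star_pCons)

lemma star_smult_left: "star d (smult a p) q = smult a (star d p q)"
  by (induction p arbitrary: q) (simp_all add: star_pCons smult_add_right)

lemma star_pCons_0: "star d (pCons 0 p) q = star d p (theta d q)"
  by (simp add: star_pCons)

text \<open>At \<open>\<lambda> = 0\<close> the composite is the operator \<open>p\<close> applied
  to the constant term of \<open>q\<close>, since \<open>\<lambda> + d\<close> reduces to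
  \<open>d\<close> there.\<close>

lemma poly_0_star:
  "additive d \<Longrightarrow> poly (star d p q) 0 = poly (star d p [:poly q 0:]) 0"
proof (induction p arbitrary: q)
  case (pCons a p)
  have "poly (theta d [:poly q 0:]) 0 = poly (theta d q) 0"
    by (simp add: theta_def poly_0_coeff_0 coeff_map_poly_additive pCons.prems)
  then show ?case
    using pCons.IH[of "theta d q"] pCons.IH[of "theta d [:poly q 0:]"] pCons.prems
    by (simp add: star_pCons)
qed simp

locale derivation = additive d for d :: "'v::comm_ring_1 \<Rightarrow> 'v" +
  assumes mult: "d (a * b) = d a * b + a * d b"
begin

lemma one: "d 1 = 0"
  using mult[of 1 1] by simp

lemma map_poly_smult: "map_poly d (smult a p) = smult (d a) p + smult a (map_poly d p)"
  by (intro poly_eqI) (simp add: coeff_map_poly zero mult)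

lemma theta_smult: "theta d (smult a p) = smult (d a) p + smult a (theta d p)"
  by (simp add: theta_def map_poly_smult smult_add_right)

text \<open>Associativity with \<open>\<partial>\<close> as the left factor; the general case is an
  induction on the order of the left operator.\<close>

lemma theta_star: "theta d (star d p q) = star d (theta d p) q"
proof (induction p arbitrary: q)
  case 0
  then show ?case by (simp add: theta_0 additive_axioms)
next
  case (pCons a p)
  have "theta d (pCons a p) = pCons (d a) (theta d p + [:a:])"
    by (simp add: theta_def map_poly_additive_pCons additive_axioms)
  then show ?case
    using pCons.IH[of "theta d q"]
    by (simp add: star_pCons theta_add additive_axioms theta_smult star_add_left star_const)
qed

lemma star_assoc: "star d (star d p q) r = star d p (star d q r)"
  by (induction p arbitrary: q)
    (simp_all add: star_pCons star_add_left star_smult_left theta_star)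

lemma star_one_right: "star d p 1 = p"
proof -
  \<comment> \<open>The claim is generalised from 1 to every \<open>q\<close> whose coefficients are
    killed by \<open>d\<close>: on these \<open>\<lambda> + d\<close> is plain multiplication by
    \<open>\<lambda>\<close>, and the class is stable under it.\<close>
  have "star d p q = p * q" if "map_poly d q = 0" for q
    using that
  proof (induction p arbitrary: q)
    case (pCons a p)
    have "theta d q = pCons 0 q" using pCons.prems by (simp add: theta_def)
    moreover have "map_poly d (pCons 0 q) = 0"
      using pCons.prems by (simp add: map_poly_additive_pCons additive_axioms zero)
    ultimately show ?case
      using pCons.IH[of "pCons 0 q"] by (simp add: star_pCons)
  qed simp
  moreover have "map_poly d 1 = 0"
    by (simp add: one_pCons map_poly_additive_pCons additive_axioms one)
  ultimately show ?thesis by simp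
qed

lemma subst_skew_smult: "subst_skew d (smult a p) = star d (subst_skew d p) [:a:]"
  by (induction p)
    (simp_all add: subst_skew_0 subst_skew_pCons additive_axioms star_diff_left star_const
      theta_star mult.commute)

text \<open>Induction on the order of \<open>p\<close>: a factor \<open>\<partial>\<close> of
  \<open>p\<close> passes to \<open>q\<close> as \<open>theta\<close>, its adjoint there is
  \<open>-\<lambda>\<close>, and \<open>star_pCons_0\<close> hands it on to the adjoint of
  \<open>p\<close>.\<close>

lemma subst_skew_star: "subst_skew d (star d p q) = star d (subst_skew d q) (subst_skew d p)"
proof (induction p arbitrary: q)
  case 0
  have "star d x 0 = 0" for x
    using additive.zero[OF additiveI[of "star d x"]] star_add_right additive_axioms by blast
  then show ?case by (simp add: subst_skew_0 additive_axioms)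
next
  case (pCons a p)
  then show ?case
    by (simp add: star_pCons subst_skew_add subst_skew_smult additive_axioms subst_skew_theta
        subst_skew_pCons star_diff_right star_minus_left star_pCons_0)
qed

end

section \<open>Derivations of the differential polynomial algebra\<close>

abbreviation mlookup where "mlookup \<equiv> Poly_Mapping.lookup"
abbreviation mkeys where "mkeys \<equiv> Poly_Mapping.keys"
abbreviation msingle where "msingle \<equiv> Poly_Mapping.single"

text \<open>Induction along addition of single terms, with no freshness of \<open>k\<close> to
  track; additive statements reduce to one term.\<close>

lemma poly_mapping_add_induct [case_names zero add]:
  fixes f :: "'a \<Rightarrow>\<^sub>0 'b::monoid_add"
  assumes "P 0" and "\<And>f k v. P f \<Longrightarrow> P (f + msingle k v)"
  shows "P f"
proof (induction f rule: Poly_Mapping.update_induct)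
  case (update f k v)
  have "Poly_Mapping.update k v f = f + msingle k v"
    using update(1) by (intro poly_mapping_eqI)
      (auto simp: Poly_Mapping.lookup_update lookup_add lookup_single in_keys_iff when_def)
  then show ?case using assms(2)[OF update(3)] by simp
qed (use assms in simp)

lemma vir_const_0 [simp]: "vir_const 0 = 0"
  and vir_const_1 [simp]: "vir_const 1 = 1"
  and vir_const_add: "vir_const (a + b) = vir_const a + vir_const b"
  and vir_const_diff: "vir_const (a - b) = vir_const a - vir_const b"
  and vir_const_minus: "vir_const (- a) = - vir_const a"
  and vir_const_mult: "vir_const (a * b) = vir_const a * vir_const b"
  and vir_const_numeral: "vir_const (numeral w) = numeral w"
  and vir_const_of_nat: "vir_const (of_nat n) = of_nat n"
  by (simp_all add: vir_const_def single_add single_diff single_uminus mult_single)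

lemma vir_const_power: "vir_const (a ^ n) = vir_const a ^ n"
  by (induction n) (simp_all add: vir_const_mult)

lemma vir_const_inject: "vir_const a = vir_const b \<longleftrightarrow> a = b"
  by (metis vir_const_def lookup_single_eq)

lemma lookup_vir_const_mult: "mlookup (vir_const k * f) m = k * mlookup f m"
  by (induction f rule: poly_mapping_add_induct)
    (simp_all add: vir_const_def distrib_left lookup_add mult_single lookup_single when_def)

lemma vir_induct [case_names const gen add mult]:
  fixes f :: "'a::field_char_0 vir"
  assumes const: "\<And>k. P (vir_const k)" and gen: "\<And>n. P (vir_L n)"
    and add: "\<And>f g. P f \<Longrightarrow> P g \<Longrightarrow> P (f + g)"
    and mult: "\<And>f g. P f \<Longrightarrow> P g \<Longrightarrow> P (f * g)"
  shows "P f"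
proof -
  have one: "P 1" using const[of 1] by simp
  have pow: "P (msingle (msingle n j) 1)" for n j :: nat
  proof (induction j)
    case (Suc j)
    have "msingle (msingle n (Suc j)) (1::'a) = vir_L n * msingle (msingle n j) 1"
      by (simp add: vir_L_def mult_single single_add[symmetric])
    then show ?case using mult[OF gen Suc] by simp
  qed (use one in simp)
  have mon: "P (msingle m 1)" for m :: "nat \<Rightarrow>\<^sub>0 nat"
  proof (induction m rule: poly_mapping_add_induct)
    case (add m n j)
    have "msingle (m + msingle n j) (1::'a) = msingle m 1 * msingle (msingle n j) 1"
      by (simp add: mult_single)
    then show ?case using mult[OF add pow] by simp
  qed (use one in simp)
  show ?thesis
  proof (induction f rule: poly_mapping_add_induct)
    case zero
    show ?case using const[of 0] by simp
  next
    case (add f m k)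
    have "msingle m k = vir_const k * msingle m 1"
      by (simp add: vir_const_def mult_single)
    then have "P (msingle m k)" using mult[OF const mon] by simp
    with add show ?case by (rule assms(3))
  qed
qed

interpretation vir: module vir_scale
  by standard (simp_all add: vir_scale_def vir_const_add vir_const_mult algebra_simps)

text \<open>Linearity over the field and killing the constants are the same for a derivation:
  \<open>D(k 1) = k D(1) = 0\<close> in one direction, the Leibniz rule in the other.\<close>

lemma alg_derivation_vir_iff:
  "alg_derivation vir_scale D \<longleftrightarrow>
     derivation D \<and> (\<forall>k. D (vir_const k) = 0)"
proof
  assume D: "alg_derivation vir_scale D"
  then interpret module_hom vir_scale vir_scale D by (simp add: alg_derivation_def)
  have d: "derivation D"
    using D by unfold_locales (simp_all add: alg_derivation_def add)
  have "D (vir_const k) = 0" for k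
    using scale[of k 1] derivation.one[OF d] by (simp add: vir_scale_def)
  with d show "derivation D \<and> (\<forall>k. D (vir_const k) = 0)" by simp
next
  assume D: "derivation D \<and> (\<forall>k. D (vir_const k) = 0)"
  then interpret derivation D by simp
  show "alg_derivation vir_scale D"
    unfolding alg_derivation_def
    by (auto intro!: module_hom.intro module_hom_axioms.intro vir.module_axioms
        simp: add mult vir_scale_def D)
qed

locale vir_derivation = derivation D for D :: "'a::field_char_0 vir \<Rightarrow> 'a vir" +
  assumes const: "D (vir_const k) = 0"
begin

lemma const_mult: "D (vir_const k * f) = vir_const k * D f"
  by (simp add: mult const)

end

lemma vir_derivationI:
  assumes "\<And>f g. D (f + g) = D f + D g" "\<And>f g. D (f * g) = D f * g + f * D g"
    "\<And>k. D (vir_const k) = 0"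
  shows "vir_derivation D"
  by unfold_locales (rule assms)+

lemma alg_derivation_iff_vir_derivation: "alg_derivation vir_scale D \<longleftrightarrow> vir_derivation D"
  by (simp add: alg_derivation_vir_iff vir_derivation_def vir_derivation_axioms_def)

lemma vir_derivation_eqI:
  assumes "vir_derivation D" "vir_derivation E" "\<And>n. D (vir_L n) = E (vir_L n)"
  shows "D f = E f"
proof -
  interpret D: vir_derivation D by fact
  interpret E: vir_derivation E by fact
  show ?thesis
    by (induction f rule: vir_induct)
      (simp_all add: D.const E.const D.add E.add D.mult E.mult assms(3))
qed

text \<open>The derivation with arbitrary values \<open>x n\<close> on the generators. It covers
  \<open>\<partial>\<close>, partial derivatives, Euler operators and evolutionary fields, so the
  Leibniz rule is proved once.\<close>

definition vir_evo :: "(nat \<Rightarrow> 'a::field_char_0 vir) \<Rightarrow> 'a vir \<Rightarrow> 'a vir" where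
  "vir_evo x f = (\<Sum>m\<in>mkeys f. \<Sum>n\<in>mkeys m.
     msingle (m - msingle n 1) (of_nat (mlookup m n) * mlookup f m) * x n)"

lemma vir_evo_single:
  "vir_evo x (msingle m k) =
     (\<Sum>n\<in>mkeys m. msingle (m - msingle n 1) (of_nat (mlookup m n) * k) * x n)"
  by (cases "k = 0") (simp_all add: vir_evo_def)

lemma vir_evo_add: "vir_evo x (f + g) = vir_evo x f + vir_evo x g"
  unfolding vir_evo_def
  by (rule setsum_keys_plus_distrib)
    (simp_all add: algebra_simps single_add sum.distrib)

lemma vir_evo_const: "vir_evo x (vir_const k) = 0"
  by (simp add: vir_const_def vir_evo_single)

lemma vir_evo_L: "vir_evo x (vir_L n) = x n"
  by (simp add: vir_L_def vir_evo_single)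

lemma vir_evo_single_mult:
  "vir_evo x (msingle m a * msingle m' b) =
     vir_evo x (msingle m a) * msingle m' b + msingle m a * vir_evo x (msingle m' b)"
proof -
  \<comment> \<open>One index set for all three monomials; terms at absent variables carry the
    factor 0.\<close>
  define K where "K = mkeys m \<union> mkeys m'"
  have K: "finite K" "mkeys m \<subseteq> K" "mkeys m' \<subseteq> K" "mkeys (m + m') \<subseteq> K"
    using keys_add[of m m'] by (auto simp: K_def)
  have ext: "vir_evo x (msingle l k) =
      (\<Sum>n\<in>K. msingle (l - msingle n 1) (of_nat (mlookup l n) * k) * x n)"
    if "mkeys l \<subseteq> K" for l k
    unfolding vir_evo_single using that K(1)
    by (intro sum.mono_neutral_left) (auto simp: in_keys_iff)
  \<comment> \<open>Where the exponent of \<open>n\<close> in \<open>l\<close> is 0, truncated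
    subtraction may give a wrong monomial, but the numerical factor vanishes.\<close>
  have sub: "msingle (l + l' - msingle n 1) (of_nat (mlookup l n) * k) =
      msingle (l - msingle n 1) (of_nat (mlookup l n)) * msingle l' k"
    for l l' :: "nat \<Rightarrow>\<^sub>0 nat" and n and k :: 'a
  proof (cases "mlookup l n = 0")
    case False
    then have "l + l' - msingle n 1 = (l - msingle n 1) + l'"
      by (intro poly_mapping_eqI) (auto simp: lookup_add lookup_minus lookup_single when_def)
    then show ?thesis by (simp add: mult_single)
  qed simp
  have "vir_evo x (msingle m a * msingle m' b) =
      (\<Sum>n\<in>K. (msingle (m + m' - msingle n 1) (of_nat (mlookup m n) * (a * b)) +
        msingle (m' + m - msingle n 1) (of_nat (mlookup m' n) * (a * b))) * x n)"
    by (simp add: mult_single ext[OF K(4)] lookup_add distrib_right single_add[symmetric]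
        algebra_simps)
  also have "\<dots> = (\<Sum>n\<in>K.
      msingle (m - msingle n 1) (of_nat (mlookup m n) * a) * x n * msingle m' b +
      msingle m a * (msingle (m' - msingle n 1) (of_nat (mlookup m' n) * b) * x n))"
    unfolding sub by (intro sum.cong refl) (simp add: mult_single algebra_simps)
  finally show ?thesis
    by (simp add: ext[OF K(2)] ext[OF K(3)] sum.distrib sum_distrib_left sum_distrib_right)
qed

lemma vir_evo_0 [simp]: "vir_evo x 0 = 0"
  by (simp add: vir_evo_def)

lemma vir_evo_mult: "vir_evo x (f * g) = vir_evo x f * g + f * vir_evo x g"
proof (induction f rule: poly_mapping_add_induct)
  case (add f m a)
  have "vir_evo x (msingle m a * g) = vir_evo x (msingle m a) * g + msingle m a * vir_evo x g"
    by (induction g rule: poly_mapping_add_induct)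
      (simp_all add: distrib_left vir_evo_add vir_evo_single_mult)
  with add show ?case by (simp add: distrib_left distrib_right vir_evo_add)
qed simp

lemma vir_derivation_evo: "vir_derivation (vir_evo x)"
  by (rule vir_derivationI) (simp_all add: vir_evo_add vir_evo_mult vir_evo_const)

lemma vir_der_eq_evo: "vir_der f = vir_evo (\<lambda>n. vir_L (Suc n)) f"
  by (simp add: vir_der_def vir_evo_def vir_L_def mult_single)

interpretation der: vir_derivation vir_der
  using vir_derivation_evo[of "\<lambda>n. vir_L (Suc n)"] by (simp add: vir_der_eq_evo[abs_def])

lemmas der_additive = der.additive_axioms

lemma vir_der_L: "vir_der (vir_L n) = vir_L (Suc n)"
  by (simp add: vir_der_eq_evo vir_evo_L)

lemma vir_derivation_evolutionary_eqI:
  assumes D: "vir_derivation D" "\<And>f. D (vir_der f) = vir_der (D f)"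
    and E: "vir_derivation E" "\<And>f. E (vir_der f) = vir_der (E f)"
    and eq: "D (vir_L 0) = E (vir_L 0)"
  shows "D f = E f"
proof (rule vir_derivation_eqI[OF D(1) E(1)])
  show "D (vir_L n) = E (vir_L n)" for n
    by (induction n) (simp_all add: eq vir_der_L[symmetric] D(2) E(2))
qed

lemma vir_derivation_commutator:
  assumes "vir_derivation D" "vir_derivation E"
  shows "vir_derivation (\<lambda>f. D (E f) - E (D f))"
proof -
  interpret D: vir_derivation D by fact
  interpret E: vir_derivation E by fact
  show ?thesis
    by (rule vir_derivationI)
      (simp_all add: D.add E.add D.mult E.mult D.const E.const D.zero E.zero algebra_simps)
qed

lemma vir_derivation_add:
  assumes "vir_derivation D" "vir_derivation E"
  shows "vir_derivation (\<lambda>f. D f + E f)" "vir_derivation (\<lambda>f. D f - E f)"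
proof -
  interpret D: vir_derivation D by fact
  interpret E: vir_derivation E by fact
  show "vir_derivation (\<lambda>f. D f + E f)" "vir_derivation (\<lambda>f. D f - E f)"
    by (rule vir_derivationI;
        simp add: D.add E.add D.mult E.mult D.const E.const algebra_simps)+
qed

text \<open>The evolutionary vector field of characteristic \<open>h\<close>: the derivation
  commuting with \<open>\<partial>\<close> that sends \<open>L\<close> to \<open>h\<close>.\<close>

definition vir_evo_field :: "'a::field_char_0 vir \<Rightarrow> 'a vir \<Rightarrow> 'a vir" where
  "vir_evo_field h = vir_evo (\<lambda>n. (vir_der ^^ n) h)"

lemma vir_derivation_evo_field: "vir_derivation (vir_evo_field h)"
  unfolding vir_evo_field_def by (rule vir_derivation_evo)

lemma vir_evo_field_L: "vir_evo_field h (vir_L 0) = h"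
  by (simp add: vir_evo_field_def vir_evo_L)

text \<open>The commutator with \<open>\<partial>\<close> is again a derivation, and it vanishes on
  the generators.\<close>

lemma vir_evo_field_der: "vir_evo_field h (vir_der f) = vir_der (vir_evo_field h f)"
proof -
  have "vir_evo_field h (vir_der f) - vir_der (vir_evo_field h f) = vir_evo (\<lambda>_. 0) f"
    by (rule vir_derivation_eqI[OF
          vir_derivation_commutator[OF vir_derivation_evo_field der.vir_derivation_axioms]
          vir_derivation_evo])
      (simp add: vir_der_L vir_evo_L vir_evo_field_def)
  then show ?thesis by (simp add: vir_evo_def)
qed

subsection \<open>Partial and Frechet derivatives\<close>

definition vir_pd :: "nat \<Rightarrow> 'a::field_char_0 vir \<Rightarrow> 'a vir" where
  "vir_pd n = vir_evo (\<lambda>k. if k = n then 1 else 0)"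

lemma vir_derivation_pd: "vir_derivation (vir_pd n)"
  unfolding vir_pd_def by (rule vir_derivation_evo)

interpretation pd: vir_derivation "vir_pd n" for n
  by (rule vir_derivation_pd)

lemma vir_pd_L: "vir_pd n (vir_L k) = (if k = n then 1 else 0)"
  by (simp add: vir_pd_def vir_evo_L)

text \<open>This finiteness makes the Frechet derivative below a polynomial symbol.\<close>

lemma vir_pd_eventually_0: "\<exists>N. \<forall>n>N. vir_pd n f = 0"
proof (induction f rule: vir_induct)
  case (gen n)
  then show ?case by (intro exI[of _ n]) (simp add: vir_pd_L)
next
  case (add f g)
  then obtain M N where "\<forall>n>M. vir_pd n f = 0" "\<forall>n>N. vir_pd n g = 0" by blast
  then show ?case by (intro exI[of _ "max M N"]) (simp add: pd.add)
next
  case (mult f g)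
  then obtain M N where "\<forall>n>M. vir_pd n f = 0" "\<forall>n>N. vir_pd n g = 0" by blast
  then show ?case by (intro exI[of _ "max M N"]) (simp add: pd.mult)
qed (simp add: pd.const)

lemma lookup_vir_pd:
  "mlookup (vir_pd n f) m = of_nat (Suc (mlookup m n)) * mlookup f (m + msingle n 1)"
proof (induction f rule: poly_mapping_add_induct)
  case zero
  then show ?case by (simp add: pd.zero)
next
  case (add f l k)
  have "vir_pd n (msingle l k) = msingle (l - msingle n 1) (of_nat (mlookup l n) * k)"
    unfolding vir_pd_def vir_evo_single
    by (cases "n \<in> mkeys l")
      (auto simp: in_keys_iff if_distrib[of "(*) _"] sum.delta' cong: if_cong)
  moreover have "mlookup (msingle (l - msingle n 1) (of_nat (mlookup l n) * k)) m =
      of_nat (Suc (mlookup m n)) * mlookup (msingle l k) (m + msingle n 1)"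
  proof (cases "l = m + msingle n 1")
    case True
    then show ?thesis by (simp add: lookup_add)
  next
    case False
    have "mlookup l n = 0 \<or> l - msingle n 1 \<noteq> m"
    proof (rule ccontr)
      assume *: "\<not> ?thesis"
      then have "l = m + msingle n 1"
        by (intro poly_mapping_eqI) (auto simp: lookup_add lookup_minus lookup_single when_def)
      with False show False by simp
    qed
    then show ?thesis using False by (auto simp: lookup_single when_def)
  qed
  ultimately show ?case using add by (simp add: pd.add lookup_add distrib_left)
qed

definition vir_frechet :: "'a::field_char_0 vir \<Rightarrow> 'a vir poly" where
  "vir_frechet f = Abs_poly (\<lambda>n. vir_pd n f)"

lemma coeff_vir_frechet: "coeff (vir_frechet f) n = vir_pd n f"
proof -
  obtain N where "\<forall>n>N. vir_pd n f = 0" using vir_pd_eventually_0 by blast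
  then show ?thesis unfolding vir_frechet_def by (subst coeff_Abs_poly[of N]) auto
qed

lemma vir_frechet_add: "vir_frechet (f + g) = vir_frechet f + vir_frechet g"
  and vir_frechet_mult: "vir_frechet (f * g) = smult f (vir_frechet g) + smult g (vir_frechet f)"
  and vir_frechet_const: "vir_frechet (vir_const k) = 0"
  and vir_frechet_L: "vir_frechet (vir_L n) = monom 1 n"
  by (intro poly_eqI; simp add: coeff_vir_frechet pd.add pd.mult pd.const vir_pd_L algebra_simps
      coeff_monom)+

lemma theta_const: "theta vir_der [:f:] = [:vir_der f, f:]"
  by (simp add: theta_def map_poly_additive_pCons der_additive)

text \<open>Coefficient by coefficient this is the commutator rule
  \<open>[\<partial>/\<partial>L_n, \<partial>] = \<partial>/\<partial>L_(n-1)\<close>, the right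
  side being 0 for \<open>n = 0\<close>.\<close>

lemma vir_frechet_der: "vir_frechet (vir_der f) = theta vir_der (vir_frechet f)"
proof (induction f rule: vir_induct)
  case (const k)
  then show ?case by (simp add: der.const vir_frechet_const theta_0 der_additive
      vir_frechet_const[of 0, simplified])
next
  case (gen n)
  have "map_poly vir_der (monom (1::'a vir) n) = 0"
    by (intro poly_eqI) (simp add: coeff_map_poly_additive der_additive coeff_monom der.one der.zero)
  then show ?case
    by (simp add: vir_der_L vir_frechet_L theta_def monom_Suc)
next
  case (add f g)
  then show ?case by (simp add: der.add vir_frechet_add theta_add der_additive)
next
  case (mult f g)
  then show ?case
    by (simp add: der.mult vir_frechet_add vir_frechet_mult theta_add der_additive der.theta_smult
        algebra_simps)
qed

subsection \<open>Gradings\<close>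

definition mon_weight :: "(nat \<Rightarrow> nat) \<Rightarrow> (nat \<Rightarrow>\<^sub>0 nat) \<Rightarrow> nat" where
  "mon_weight w m = (\<Sum>n\<in>mkeys m. mlookup m n * w n)"

lemma mon_weight_add: "mon_weight w (m + m') = mon_weight w m + mon_weight w m'"
  unfolding mon_weight_def by (rule setsum_keys_plus_distrib) (simp_all add: algebra_simps)

lemma mon_weight_single: "mon_weight w (msingle n j) = j * w n"
  by (cases "j = 0") (simp_all add: mon_weight_def)

text \<open>Diagonal operators in the monomial basis serve as gradings, as projections onto graded
  pieces and as inverses of gradings.\<close>

definition vir_diag :: "((nat \<Rightarrow>\<^sub>0 nat) \<Rightarrow> 'a) \<Rightarrow> 'a::field_char_0 vir \<Rightarrow> 'a vir" where
  "vir_diag \<phi> f = Poly_Mapping.mapp (\<lambda>m k. \<phi> m * k) f"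

lemma lookup_vir_diag: "mlookup (vir_diag \<phi> f) m = \<phi> m * mlookup f m"
  by (simp add: vir_diag_def lookup_mapp when_def in_keys_iff)

lemma vir_diag_add: "vir_diag \<phi> (f + g) = vir_diag \<phi> f + vir_diag \<phi> g"
  by (intro poly_mapping_eqI) (simp add: lookup_vir_diag lookup_add algebra_simps)

lemma additive_vir_diag: "additive (vir_diag \<phi>)"
  by (rule additiveI) (rule vir_diag_add)

lemma vir_diag_single: "vir_diag \<phi> (msingle m k) = msingle m (\<phi> m * k)"
  by (intro poly_mapping_eqI) (auto simp: lookup_vir_diag lookup_single when_def)

lemma vir_diag_const: "vir_diag \<phi> (vir_const k * f) = vir_const k * vir_diag \<phi> f"
  by (intro poly_mapping_eqI) (simp add: lookup_vir_diag lookup_vir_const_mult)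

text \<open>Euler's identity for a weighted grading: each factor \<open>L_n\<close> of a monomial
  contributes \<open>w n\<close> times the monomial.\<close>

lemma vir_evo_weight:
  "vir_evo (\<lambda>n. of_nat (w n) * vir_L n) f = vir_diag (\<lambda>m. of_nat (mon_weight w m)) f"
proof (induction f rule: poly_mapping_add_induct)
  case (add f m k)
  have "msingle (m - msingle n 1) (of_nat (mlookup m n) * k) * (of_nat (w n) * vir_L n) =
      msingle m (of_nat (mlookup m n * w n) * k)" if "n \<in> mkeys m" for n
  proof -
    have "m - msingle n 1 + msingle n 1 = m" using that
      by (intro poly_mapping_eqI)
        (auto simp: lookup_add lookup_minus lookup_single when_def in_keys_iff)
    then show ?thesis
      by (simp add: vir_L_def mult_single of_nat_single algebra_simps del: single_of_nat)
  qed
  then have "vir_evo (\<lambda>n. of_nat (w n) * vir_L n) (msingle m k) =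
      (\<Sum>n\<in>mkeys m. msingle m (of_nat (mlookup m n * w n) * k))"
    unfolding vir_evo_single by simp
  also have "\<dots> = msingle m (of_nat (mon_weight w m) * k)"
    by (simp add: additive.sum[OF additiveI[of "msingle m"], OF single_add] mon_weight_def
        sum_distrib_right)
  finally show ?case using add by (simp add: vir_evo_add vir_diag_add vir_diag_single)
qed (simp add: additive.zero[OF additive_vir_diag])

subsection \<open>The variational derivative\<close>

abbreviation mon_deg :: "(nat \<Rightarrow>\<^sub>0 nat) \<Rightarrow> nat" where "mon_deg \<equiv> mon_weight (\<lambda>_. Suc 0)"

lemma mon_weight_eq_0_iff:
  assumes "\<And>n. w n > 0"
  shows "mon_weight w m = 0 \<longleftrightarrow> m = 0"
proof
  assume "mon_weight w m = 0"
  then have "\<forall>n\<in>mkeys m. mlookup m n * w n = 0"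
    by (simp add: mon_weight_def)
  moreover have "w n \<noteq> 0" for n using assms[of n] by simp
  ultimately have "mlookup m n = 0" for n by (cases "n \<in> mkeys m") (auto simp: in_keys_iff)
  then show "m = 0" by (intro poly_mapping_eqI) simp
qed (simp add: mon_weight_def)

lemma poly_mapping_split_single:
  fixes m :: "nat \<Rightarrow>\<^sub>0 nat"
  assumes "m \<noteq> 0"
  obtains n l where "m = l + msingle n 1"
proof -
  from assms obtain n where n: "n \<in> mkeys m"
    by (metis keys_eq_empty all_not_in_conv)
  have "m = (m - msingle n 1) + msingle n 1" using n
    by (intro poly_mapping_eqI)
      (auto simp: lookup_add lookup_minus lookup_single when_def in_keys_iff)
  then show thesis by (rule that)
qed

lemma theta_eq_0_iff:
  assumes d: "additive d"
  shows "theta d p = 0 \<longleftrightarrow> p = 0"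
proof
  assume "theta d p = 0"
  \<comment> \<open>One degree above that of \<open>p\<close>, the coefficient of
    \<open>(\<lambda> + d) p\<close> is the leading coefficient of \<open>p\<close>.\<close>
  then have "coeff (theta d p) (Suc (degree p)) = 0" by simp
  then show "p = 0"
    by (simp add: coeff_theta[OF d] coeff_eq_0 additive.zero[OF d])
qed (simp add: theta_0 d)

text \<open>Frechet derivatives turn the hypothesis into
  \<open>(\<lambda> + \<partial>) D(f) = 0\<close>, so all partial derivatives of \<open>f\<close>
  vanish; in characteristic 0 only the constant term survives.\<close>

lemma vir_der_eq_0:
  assumes "vir_der f = 0"
  shows "f = vir_const (mlookup f 0)"
proof -
  have "theta vir_der (vir_frechet f) = 0"
    using vir_frechet_der[of f] vir_frechet_const[of "0::'a"] assms by simp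
  then have "vir_frechet f = 0" by (simp add: theta_eq_0_iff der_additive)
  then have pd: "vir_pd n f = 0" for n by (simp flip: coeff_vir_frechet)
  have "mlookup f m = 0" if m: "m \<noteq> 0" for m
  proof -
    from m obtain n l where ml: "m = l + msingle n 1" by (rule poly_mapping_split_single)
    have "of_nat (Suc (mlookup l n)) * mlookup f m = 0"
      using lookup_vir_pd[of n f l] pd[of n] ml by simp
    then show ?thesis by (simp only: mult_eq_0_iff of_nat_eq_0_iff) simp
  qed
  then show ?thesis
    by (intro poly_mapping_eqI) (auto simp: vir_const_def lookup_single when_def)
qed

text \<open>The variational derivative, the sum of
  \<open>(-\<partial>)^n (\<partial>f/\<partial>L_n)\<close>, as the constant term of the adjoint of
  the Frechet derivative.\<close>

definition vir_delta :: "'a::field_char_0 vir \<Rightarrow> 'a vir" where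
  "vir_delta f = poly (subst_skew vir_der (vir_frechet f)) 0"

lemma poly_0_star_pCons:
  "poly (star vir_der (pCons a p) [:v:]) 0 = a * v + poly (star vir_der p [:vir_der v:]) 0"
  using poly_0_star[OF der_additive, of p "[:vir_der v, v:]"]
  by (simp add: star_pCons theta_const)

text \<open>The left side is the operator \<open>p\<close> applied to \<open>v\<close>, and the
  factor of \<open>v\<close> is the adjoint of \<open>p\<close> applied to 1. Each order moves one
  \<open>\<partial>\<close> off \<open>v\<close> at the cost of a total derivative.\<close>

lemma integration_by_parts:
  "\<exists>w. poly (star vir_der p [:v:]) 0 = v * poly (subst_skew vir_der p) 0 + vir_der w"
proof (induction p arbitrary: v)
  case 0
  show ?case by (intro exI[of _ 0]) (simp add: subst_skew_0 der_additive der.zero)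
next
  case (pCons a p)
  obtain w where w: "poly (star vir_der p [:vir_der v:]) 0 =
      vir_der v * poly (subst_skew vir_der p) 0 + vir_der w"
    using pCons.IH by blast
  have "poly (theta vir_der q) 0 = vir_der (poly q 0)" for q :: "'a vir poly"
    by (simp add: theta_def poly_0_coeff_0 coeff_map_poly_additive der_additive)
  then show ?case
    by (intro exI[of _ "w + v * poly (subst_skew vir_der p) 0"])
      (simp add: poly_0_star_pCons w subst_skew_pCons der_additive der.add der.mult algebra_simps)
qed

text \<open>The Frechet derivative applied to \<open>L\<close> is the sum of
  \<open>L_n \<partial>f/\<partial>L_n\<close>, the Euler operator of the polynomial degree.\<close>

lemma euler_operator:
  "poly (star vir_der (vir_frechet f) [:vir_L 0:]) 0 = vir_diag (\<lambda>m. of_nat (mon_deg m)) f"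
proof -
  have gen: "poly (star vir_der (monom 1 n) [:vir_L k:]) 0 = vir_L (n + k)" for n k
  proof (induction n arbitrary: k)
    case 0
    then show ?case by (simp add: monom_0 star_const)
  next
    case (Suc n)
    then show ?case by (simp add: monom_Suc poly_0_star_pCons vir_der_L)
  qed
  have "vir_derivation (\<lambda>f. poly (star vir_der (vir_frechet f) [:vir_L 0:]) 0)"
    by (rule vir_derivationI)
      (simp_all add: vir_frechet_add vir_frechet_mult vir_frechet_const star_add_left
        star_smult_left algebra_simps)
  then have "poly (star vir_der (vir_frechet f) [:vir_L 0:]) 0 =
      vir_evo (\<lambda>n. of_nat (Suc 0) * vir_L n) f"
    by (rule vir_derivation_eqI[OF _ vir_derivation_evo])
      (simp add: vir_frechet_L gen vir_evo_L)
  then show ?thesis using vir_evo_weight[of "\<lambda>_. Suc 0" f] by simp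
qed

text \<open>\<open>Suc\<close> appears because a partial derivative lowers the polynomial degree by
  one.\<close>

lemma vir_diag_pd:
  "vir_pd n (vir_diag (\<lambda>m. \<phi> (mon_deg m)) f) = vir_diag (\<lambda>m. \<phi> (Suc (mon_deg m))) (vir_pd n f)"
  by (intro poly_mapping_eqI)
    (simp add: lookup_vir_pd lookup_vir_diag mon_weight_add mon_weight_single)

lemma vir_diag_frechet:
  "vir_frechet (vir_diag (\<lambda>m. \<phi> (mon_deg m)) f) =
     map_poly (vir_diag (\<lambda>m. \<phi> (Suc (mon_deg m)))) (vir_frechet f)"
  by (intro poly_eqI)
    (simp add: coeff_vir_frechet vir_diag_pd coeff_map_poly_additive additive_vir_diag)

lemma vir_diag_L:
  "vir_diag (\<lambda>m. \<phi> (mon_deg m)) (vir_L n * f) = vir_L n * vir_diag (\<lambda>m. \<phi> (Suc (mon_deg m))) f"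
proof (induction f rule: poly_mapping_add_induct)
  case (add f m k)
  then show ?case
    by (simp add: distrib_left vir_diag_add vir_diag_single vir_L_def mult_single mon_weight_add
        mon_weight_single)
qed (simp add: additive.zero[OF additive_vir_diag])

lemma vir_diag_der:
  "vir_diag (\<lambda>m. \<phi> (mon_deg m)) (vir_der f) = vir_der (vir_diag (\<lambda>m. \<phi> (mon_deg m)) f)"
proof (induction f rule: poly_mapping_add_induct)
  case (add f m k)
  have "mon_deg (m - msingle n 1 + msingle (Suc n) 1) = mon_deg m" if "n \<in> mkeys m" for n
  proof -
    have "m = (m - msingle n 1) + msingle n 1" using that
      by (intro poly_mapping_eqI)
        (auto simp: lookup_add lookup_minus lookup_single when_def in_keys_iff)
    then have "mon_deg m = mon_deg (m - msingle n 1) + mon_deg (msingle n 1)"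
      by (metis mon_weight_add)
    then show ?thesis by (simp add: mon_weight_add mon_weight_single)
  qed
  then have "vir_diag (\<lambda>m. \<phi> (mon_deg m)) (vir_der (msingle m k)) =
      vir_der (msingle m (\<phi> (mon_deg m) * k))"
    by (simp add: vir_der_eq_evo vir_evo_single additive.sum[OF additive_vir_diag] vir_L_def
        mult_single vir_diag_single mult.left_commute)
  with add show ?case by (simp add: der.add vir_diag_add vir_diag_single)
qed (simp add: additive.zero[OF additive_vir_diag] der.zero)

text \<open>Dividing \<open>f\<close> by the polynomial degree gives \<open>h\<close>, still with
  \<open>\<delta>h = 0\<close>. The Euler operator recovers \<open>f\<close> from \<open>h\<close>
  up to a constant, and integration by parts writes its value as \<open>L \<delta>h\<close> plus a
  total derivative.\<close>

lemma vir_delta_eq_0: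
  fixes f :: "'a::field_char_0 vir"
  assumes "vir_delta f = 0"
  obtains k g where "f = vir_const k + vir_der g"
proof -
  \<comment> \<open>As \<open>inverse 0 = 0\<close>, the constant term of \<open>f\<close> is lost
    in \<open>h\<close>; it returns as \<open>k\<close>.\<close>
  define \<phi> :: "nat \<Rightarrow> 'a" where "\<phi> n = inverse (of_nat n)" for n
  define h where "h = vir_diag (\<lambda>m. \<phi> (mon_deg m)) f"
  have "vir_delta h = poly (map_poly (vir_diag (\<lambda>m. \<phi> (Suc (mon_deg m))))
      (subst_skew vir_der (vir_frechet f))) 0"
    unfolding vir_delta_def h_def vir_diag_frechet
    by (subst map_poly_subst_skew[OF additive_vir_diag der_additive der_additive])
      (rule vir_diag_der[of "\<lambda>n. \<phi> (Suc n)"], rule refl)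
  also have "\<dots> = vir_diag (\<lambda>m. \<phi> (Suc (mon_deg m))) (vir_delta f)"
    by (simp add: vir_delta_def poly_0_coeff_0 coeff_map_poly_additive additive_vir_diag)
  also have "\<dots> = 0" by (simp add: assms additive.zero[OF additive_vir_diag])
  finally have h: "vir_delta h = 0" .
  obtain w where "vir_diag (\<lambda>m. of_nat (mon_deg m)) h = vir_L 0 * vir_delta h + vir_der w"
    using integration_by_parts[of "vir_frechet h" "vir_L 0"]
    by (auto simp: euler_operator vir_delta_def)
  moreover have "f = vir_const (mlookup f 0) + vir_diag (\<lambda>m. of_nat (mon_deg m)) h"
    by (intro poly_mapping_eqI)
      (auto simp: h_def lookup_add lookup_vir_diag \<phi>_def vir_const_def lookup_single when_def
        mon_weight_eq_0_iff)
  ultimately show thesis using h that[of "mlookup f 0" w] by simp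
qed

lemma virasoro_operator_injective:
  fixes f :: "'a::field_char_0 vir"
  assumes "vir_L 1 * f + 2 * vir_L 0 * vir_der f +
    vir_const \<kappa> * vir_der (vir_der (vir_der f)) = 0"
  shows "f = 0"
proof (rule ccontr)
  assume "f \<noteq> 0"
  then have ne: "mkeys f \<noteq> {}" by simp
  define d where "d = Max (mon_deg ` mkeys f)"
  \<comment> \<open>The equation is projected to degree \<open>Suc d\<close>, since multiplication
    by \<open>L\<close> or \<open>L'\<close> raises the degree by one; the shifted projection then
    picks the top component \<open>g\<close> of \<open>f\<close>.\<close>
  define \<phi> :: "nat \<Rightarrow> 'a" where "\<phi> n = (if n = Suc d then 1 else 0)" for n
  define g where "g = vir_diag (\<lambda>m. \<phi> (Suc (mon_deg m))) f"
  have "d \<in> mon_deg ` mkeys f" unfolding d_def using ne by (intro Max_in) auto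
  then obtain m where m: "m \<in> mkeys f" "mon_deg m = d" by auto
  then have "mlookup g m \<noteq> 0" by (simp add: g_def lookup_vir_diag \<phi>_def in_keys_iff)
  then have "g \<noteq> 0" by auto
  have le: "mon_deg m \<le> d" if "m \<in> mkeys f" for m
    unfolding d_def using that by (intro Max_ge) auto
  have top: "vir_diag (\<lambda>m. \<phi> (mon_deg m)) f = 0"
  proof (intro poly_mapping_eqI)
    show "mlookup (vir_diag (\<lambda>m. \<phi> (mon_deg m)) f) m = mlookup 0 m" for m
      using le[of m] by (cases "m \<in> mkeys f") (auto simp: lookup_vir_diag \<phi>_def in_keys_iff)
  qed
  \<comment> \<open>The term with \<open>\<kappa>\<close> has degree at most \<open>d\<close>, so
    the projection removes it.\<close>
  have "0 = vir_diag (\<lambda>m. \<phi> (mon_deg m)) (vir_L 1 * f + 2 * (vir_L 0 * vir_der f) +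
      vir_const \<kappa> * vir_der (vir_der (vir_der f)))"
    using assms by (simp add: additive.zero[OF additive_vir_diag] mult.assoc)
  also have "\<dots> = vir_L 1 * g + 2 * vir_L 0 * vir_der g"
    using vir_diag_der[of "\<lambda>n. \<phi> (Suc n)" f]
    by (simp add: vir_diag_const[of _ 2, unfolded vir_const_numeral] vir_diag_add vir_diag_const vir_diag_L vir_diag_der top der.zero flip: g_def)
  finally have eq: "vir_L 1 * g + 2 * vir_L 0 * vir_der g = 0" by simp
  have "vir_der (vir_L 0 * (g * g)) = g * (vir_L 1 * g + 2 * vir_L 0 * vir_der g)"
    by (simp add: der.mult vir_der_L algebra_simps)
  then have "vir_der (vir_L 0 * (g * g)) = 0" by (simp only: eq mult_zero_right)
  then have "vir_L 0 * (g * g) = vir_const (mlookup (vir_L 0 * (g * g)) 0)"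
    by (rule vir_der_eq_0)
  \<comment> \<open>A multiple of \<open>L\<close> has no constant term, so the constant just found
    is 0.\<close>
  moreover have "mlookup (vir_L 0 * x) 0 = 0" for x :: "'a vir"
  proof (induction x rule: poly_mapping_add_induct)
    case (add x m k)
    have "msingle 0 1 + m \<noteq> 0"
      using mon_weight_add[of "\<lambda>_. Suc 0" "msingle 0 1" m] mon_weight_single[of "\<lambda>_. Suc 0" 0 1]
      by (auto simp: mon_weight_def)
    with add show ?case
      by (simp add: distrib_left lookup_add vir_L_def mult_single lookup_single)
  qed simp
  ultimately have "vir_L 0 * (g * g) = 0" by simp
  moreover have "vir_L 0 \<noteq> (0 :: 'a vir)"
    by (metis vir_L_def lookup_single_eq lookup_zero zero_neq_one)
  ultimately show False using \<open>g \<noteq> 0\<close> by simp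
qed

section \<open>Skew-symmetric brackets and the Jacobi identity\<close>

text \<open>The outer variable is \<open>\<mu>\<close>: inserting the constant polynomial
  \<open>[:y:]\<close> first leaves a polynomial in \<open>\<lambda>\<close>.\<close>

definition eval2 :: "'v::comm_ring_1 \<Rightarrow> 'v \<Rightarrow> 'v poly poly \<Rightarrow> 'v" where
  "eval2 x y P = poly (poly P [:y:]) x"

lemma eval2_simps:
  "eval2 x y (P + Q) = eval2 x y P + eval2 x y Q"
  "eval2 x y (P - Q) = eval2 x y P - eval2 x y Q"
  "eval2 x y (P * Q) = eval2 x y P * eval2 x y Q"
  "eval2 x y (P ^ n) = eval2 x y P ^ n"
  "eval2 x y (sum f A) = (\<Sum>i\<in>A. eval2 x y (f i))"
  "eval2 x y pva_lam = x" "eval2 x y pva_mu = y"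
  by (simp_all add: eval2_def pva_lam_def pva_mu_def poly_sum)

lemma eval2_subst2: "eval2 x y (subst2 p z) = poly p (eval2 x y z)"
  by (simp add: subst2_def eval2_simps poly_altdef) (simp add: eval2_def)

text \<open>The test set \<open>C\<close> is abstract because the lemma also serves over dual
  numbers, which have zero divisors, so that infinitely many roots alone do not force a polynomial
  to vanish.\<close>

lemma eval2_eq_0D:
  assumes C: "\<And>p. (\<And>x. x \<in> C \<Longrightarrow> poly p x = 0) \<Longrightarrow> p = 0"
    and P: "\<And>x y. x \<in> C \<Longrightarrow> y \<in> C \<Longrightarrow> eval2 x y P = 0"
  shows "P = 0"
proof -
  have 1: "poly P [:y:] = 0" if "y \<in> C" for y
    using C[of "poly P [:y:]"] P that by (simp add: eval2_def)
  have add: "additive (\<lambda>p. coeff p i)" for i :: nat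
    by (rule additiveI) simp
  have "poly (map_poly (\<lambda>p. coeff p i) P) y = coeff (poly P [:y:]) i" for i y
    by (induction P) (simp_all add: map_poly_additive_pCons add)
  then have "map_poly (\<lambda>p. coeff p i) P = 0" for i
    using C[of "map_poly (\<lambda>p. coeff p i) P"] 1 by simp
  then have "coeff (coeff P n) i = 0" for n i
    using coeff_map_poly_additive[OF add, of i P n] by simp
  then show ?thesis by (intro poly_eqI) simp
qed

definition pva_jacobiator ::
  "('v::comm_ring_1 \<Rightarrow> 'v \<Rightarrow> 'v poly) \<Rightarrow> 'v \<Rightarrow> 'v \<Rightarrow> 'v \<Rightarrow> 'v poly poly" where
  "pva_jacobiator br a b c =
     (\<Sum>j\<le>degree (br b c). pva_mu ^ j * subst2 (br a (coeff (br b c) j)) pva_lam)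
       - (\<Sum>i\<le>degree (br a c). pva_lam ^ i * subst2 (br b (coeff (br a c) i)) pva_mu)
       - (\<Sum>i\<le>degree (br a b). pva_lam ^ i * subst2 (br (coeff (br a b) i) c) (pva_lam + pva_mu))"

text \<open>Such elements can be substituted for \<open>\<lambda>\<close> or \<open>\<mu>\<close>
  and pulled through brackets.\<close>

definition bracket_constant :: "('v::comm_ring_1 \<Rightarrow> 'v \<Rightarrow> 'v poly) \<Rightarrow> 'v \<Rightarrow> bool" where
  "bracket_constant br x \<longleftrightarrow>
     (\<forall>a b. br (x * a) b = smult x (br a b) \<and> br a (x * b) = smult x (br a b))"

lemma poly_linear_poly:
  fixes T :: "'v::comm_ring_1 \<Rightarrow> 'v poly"
  assumes T: "additive T" "\<And>v. T (y * v) = smult y (T v)"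
  shows "(\<Sum>j\<le>degree q. y ^ j * poly (T (coeff q j)) x) = poly (T (poly q y)) x"
proof -
  have "T (y ^ j * v) = smult (y ^ j) (T v)" for j v
    by (induction j) (simp_all add: T(2) mult.assoc)
  then have "T (poly q y) = (\<Sum>j\<le>degree q. smult (y ^ j) (T (coeff q j)))"
    by (simp add: poly_altdef additive.sum[OF T(1)] mult.commute)
  then show ?thesis by (simp add: poly_sum)
qed

lemma eval2_pva_jacobiator:
  assumes "\<And>a. additive (br a)" "\<And>b. additive (\<lambda>a. br a b)"
    and "bracket_constant br x" "bracket_constant br y"
  shows "eval2 x y (pva_jacobiator br a b c) =
    poly (br a (poly (br b c) y)) x - poly (br b (poly (br a c) x)) y
      - poly (br (poly (br a b) x) c) (x + y)"
  using assms poly_linear_poly[of "br a" y "br b c" x] poly_linear_poly[of "br b" x "br a c" y]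
    poly_linear_poly[of "\<lambda>v. br v c" x "br a b" "x + y"]
  by (simp add: pva_jacobiator_def eval2_simps eval2_subst2 bracket_constant_def)

text \<open>A field of characteristic 0 supplies infinitely many constants, and the polynomial
  algebra is a domain.\<close>

lemma vir_const_poly_eqI:
  fixes p q :: "'a::field_char_0 vir poly"
  assumes "\<And>s. poly p (vir_const s) = poly q (vir_const s)"
  shows "p = q"
proof (rule ccontr)
  assume "p \<noteq> q"
  then have "finite {x. poly (p - q) x = 0}" by (intro poly_roots_finite) simp
  moreover have "range vir_const \<subseteq> {x. poly (p - q) x = 0}" using assms by auto
  ultimately have "finite (range (vir_const :: 'a \<Rightarrow> 'a vir))" by (rule rev_finite_subset)
  then show False by (simp add: finite_image_iff inj_on_def vir_const_inject infinite_UNIV_char_0)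
qed

lemma map_poly_vir_scale: "map_poly (vir_scale k) p = smult (vir_const k) p"
  by (intro poly_eqI) (simp add: coeff_map_poly vir_scale_def)

lemma subst_skew_const_smult:
  "subst_skew vir_der (smult (vir_const k) p) = smult (vir_const k) (subst_skew vir_der p)"
proof -
  have "additive (vir_scale k)" by (rule additiveI) (simp add: vir.scale_right_distrib)
  then show ?thesis
    using map_poly_subst_skew[of "vir_scale k" vir_der vir_der p]
    by (simp add: der_additive map_poly_vir_scale vir_scale_def der.const_mult)
qed

lemma poly_map_poly_der: "poly (map_poly vir_der p) (vir_const s) = vir_der (poly p (vir_const s))"
  by (induction p) (simp_all add: der.zero der.add der.const_mult map_poly_additive_pCons der_additive)

lemma poly_theta:
  "poly (theta vir_der p) (vir_const s) =
     vir_const s * poly p (vir_const s) + vir_der (poly p (vir_const s))"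
  by (simp add: theta_def poly_map_poly_der)

text \<open>The axioms of a Poisson vertex algebra without the Jacobi identity; the rules for the
  first argument follow by skew-symmetry. All conditions are linear in \<open>W\<close>, so cocycles
  and coboundaries fall under them too.\<close>

locale vir_skew =
  fixes W :: "'a::field_char_0 vir \<Rightarrow> 'a vir \<Rightarrow> 'a vir poly"
  assumes add_right: "W a (b + c) = W a b + W a c"
    and const_right: "W a (vir_const k * b) = smult (vir_const k) (W a b)"
    and der_right: "W a (vir_der b) = theta vir_der (W a b)"
    and leibniz: "W a (b * c) = smult c (W a b) + smult b (W a c)"
    and skew: "W a b = - subst_skew vir_der (W b a)"
begin

lemma add_left: "W (a + b) c = W a c + W b c"
  by (simp add: skew[of _ c] add_right subst_skew_add der_additive)

lemma additive_right: "additive (W a)"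
  by (rule additiveI) (rule add_right)

lemma additive_left: "additive (\<lambda>a. W a b)"
  by (rule additiveI) (rule add_left)

lemmas zero_right = additive.zero[OF additive_right]
lemmas zero_left = additive.zero[OF additive_left]
lemmas diff_right = additive.diff[OF additive_right]
lemmas diff_left = additive.diff[OF additive_left]
lemmas minus_right = additive.minus[OF additive_right]
lemmas minus_left = additive.minus[OF additive_left]

lemma const_left: "W (vir_const k * a) b = smult (vir_const k) (W a b)"
  by (simp add: skew[of _ b] const_right subst_skew_const_smult)

lemma bracket_constant_vir_const: "bracket_constant W (vir_const k)"
  by (simp add: bracket_constant_def const_left const_right)

lemma der_left: "W (vir_der a) b = - pCons 0 (W a b)"
  by (simp add: skew[of _ b] der_right subst_skew_theta der_additive)

lemma one_right: "W a 1 = 0"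
  using leibniz[of a 1 1] by simp

lemma vir_const_right: "W a (vir_const k) = 0"
  using const_right[of a k 1] by (simp add: one_right)

lemma vir_const_left: "W (vir_const k) a = 0"
  by (simp add: skew[of _ a] vir_const_right subst_skew_0 der_additive)

end

lemma vir_skew_eq_right:
  assumes "vir_skew W" "vir_skew W'" and eq: "W a (vir_L 0) = W' a (vir_L 0)"
  shows "W a b = W' a b"
proof -
  interpret W: vir_skew W by fact
  interpret W': vir_skew W' by fact
  have "W a (vir_L n) = W' a (vir_L n)" for n
    by (induction n) (simp_all add: eq W.der_right W'.der_right flip: vir_der_L)
  then show ?thesis
    by (induction b rule: vir_induct)
      (simp_all add: W.vir_const_right W'.vir_const_right W.add_right W'.add_right
        W.leibniz W'.leibniz)
qed

text \<open>Agreement is extended in the second argument, skew-symmetry exchanges the arguments, and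
  the extension is repeated.\<close>

lemma vir_skew_eqI:
  assumes W: "vir_skew W" and W': "vir_skew W'"
    and eq: "W (vir_L 0) (vir_L 0) = W' (vir_L 0) (vir_L 0)"
  shows "W a b = W' a b"
proof (rule vir_skew_eq_right[OF W W'])
  have "W (vir_L 0) a = W' (vir_L 0) a" by (rule vir_skew_eq_right[OF W W' eq])
  then show "W a (vir_L 0) = W' a (vir_L 0)"
    by (simp add: vir_skew.skew[OF W, of a] vir_skew.skew[OF W', of a])
qed

lemma vir_skew_add:
  assumes "vir_skew W" "vir_skew W'"
  shows "vir_skew (\<lambda>a b. W a b + W' a b)"
proof -
  interpret W: vir_skew W by fact
  interpret W': vir_skew W' by fact
  have skew: "W a b + W' a b = - subst_skew vir_der (W b a + W' b a)" for a b
    by (subst W.skew, subst W'.skew) (simp add: subst_skew_add der_additive)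
  show ?thesis
    by (unfold_locales; (rule skew)?)
      (simp_all add: W.add_right W'.add_right W.const_right W'.const_right W.der_right W'.der_right
        W.leibniz W'.leibniz W.vir_const_right W'.vir_const_right smult_add_right theta_add
        der_additive)
qed

lemma vir_skew_smult:
  assumes "vir_skew W"
  shows "vir_skew (\<lambda>a b. smult (vir_const k) (W a b))"
proof -
  interpret W: vir_skew W by fact
  have skew: "smult (vir_const k) (W a b) = - subst_skew vir_der (smult (vir_const k) (W b a))" for a b
    by (subst W.skew) (simp add: subst_skew_const_smult)
  show ?thesis
    by (unfold_locales; (rule skew)?)
      (simp_all add: W.add_right W.const_right W.der_right W.leibniz W.vir_const_right smult_add_right
        der.theta_smult der.const mult.commute)
qed

text \<open>The failure of \<open>D\<close> to be a derivation of the bracket, which is the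
  first-order change of \<open>W\<close> under \<open>id + \<epsilon> D\<close>.\<close>

definition bracket_coboundary ::
  "('v::comm_ring_1 \<Rightarrow> 'v \<Rightarrow> 'v poly) \<Rightarrow> ('v \<Rightarrow> 'v) \<Rightarrow> 'v \<Rightarrow> 'v \<Rightarrow> 'v poly" where
  "bracket_coboundary W D a b = W (D a) b + W a (D b) - map_poly D (W a b)"

lemma vir_skew_coboundary:
  assumes "vir_skew W" "vir_derivation D" and comm: "\<And>f. D (vir_der f) = vir_der (D f)"
  shows "vir_skew (bracket_coboundary W D)"
proof -
  interpret W: vir_skew W by fact
  interpret D: vir_derivation D by fact
  have skew: "bracket_coboundary W D a b = - subst_skew vir_der (bracket_coboundary W D b a)" for a b
  proof -
    have "map_poly D (W a b) = - subst_skew vir_der (map_poly D (W b a))"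
      by (subst W.skew)
        (simp add: map_poly_minus D.additive_axioms
          map_poly_subst_skew[OF D.additive_axioms der_additive der_additive comm])
    moreover have "W (D a) b = - subst_skew vir_der (W b (D a))"
      "W a (D b) = - subst_skew vir_der (W (D b) a)" by (rule W.skew)+
    ultimately show ?thesis
      by (simp add: bracket_coboundary_def subst_skew_add subst_skew_diff der_additive)
  qed
  show ?thesis
    by (unfold_locales; (rule skew)?)
      (simp_all add: bracket_coboundary_def W.add_right W.const_right W.der_right W.leibniz W.vir_const_right D.add
        D.mult D.const_mult comm map_poly_add D.additive_axioms D.map_poly_smult theta_add
        theta_diff der_additive D.const map_poly_theta[OF D.additive_axioms der_additive
          der_additive comm] smult_add_right smult_diff_right algebra_simps)
qed

text \<open>The master formula for brackets of differential polynomials in one generator,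
  \<open>H\<close> being the bracket of the generator with itself.\<close>

definition vir_op_bracket :: "'a::field_char_0 vir poly \<Rightarrow> 'a vir \<Rightarrow> 'a vir \<Rightarrow> 'a vir poly" where
  "vir_op_bracket H a b =
     star vir_der (vir_frechet b) (star vir_der H (subst_skew vir_der (vir_frechet a)))"

lemma vir_op_bracket_L: "vir_op_bracket H (vir_L 0) (vir_L 0) = H"
  by (simp add: vir_op_bracket_def vir_frechet_L star_const subst_skew_const der_additive
      monom_0 der.star_one_right[unfolded one_pCons] del: one_poly_eq_simps)

lemma vir_skew_op_bracket:
  assumes H: "subst_skew vir_der H = - H"
  shows "vir_skew (vir_op_bracket H)"
proof
  show "vir_op_bracket H a b = - subst_skew vir_der (vir_op_bracket H b a)" for a b
    by (simp add: vir_op_bracket_def der.subst_skew_star subst_skew_involution der_additive H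
        star_minus_left star_minus_right der.star_assoc)
qed (simp_all add: vir_op_bracket_def vir_frechet_add vir_frechet_mult vir_frechet_const
    vir_frechet_der star_add_left star_smult_left der.theta_star add.commute)

lemma vir_op_bracket_add:
  "vir_op_bracket (G + H) a b = vir_op_bracket G a b + vir_op_bracket H a b"
  by (simp add: vir_op_bracket_def star_add_left star_add_right der_additive)

subsection \<open>Reducing the Jacobi identity to the generator\<close>

text \<open>Specialising \<open>\<lambda>\<close> to field constants replaces identities in
  \<open>V[\<lambda>,\<mu>]\<close> by identities in \<open>V\<close>.\<close>

definition vir_ev ::
  "('a::field_char_0 vir \<Rightarrow> 'a vir \<Rightarrow> 'a vir poly) \<Rightarrow> 'a \<Rightarrow> 'a vir \<Rightarrow> 'a vir \<Rightarrow> 'a vir" where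
  "vir_ev W s a b = poly (W a b) (vir_const s)"

definition vir_jacobiator ::
  "('a::field_char_0 vir \<Rightarrow> 'a vir \<Rightarrow> 'a vir poly) \<Rightarrow> 'a \<Rightarrow> 'a \<Rightarrow> 'a vir \<Rightarrow> 'a vir \<Rightarrow> 'a vir \<Rightarrow> 'a vir"
  where "vir_jacobiator W s t a b c =
    vir_ev W s a (vir_ev W t b c) - vir_ev W t b (vir_ev W s a c)
      - vir_ev W (s + t) (vir_ev W s a b) c"

context vir_skew
begin

lemma ev_add_right: "vir_ev W s a (b + c) = vir_ev W s a b + vir_ev W s a c"
  and ev_add_left: "vir_ev W s (a + b) c = vir_ev W s a c + vir_ev W s b c"
  and ev_diff_left: "vir_ev W s (a - b) c = vir_ev W s a c - vir_ev W s b c"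
  and ev_zero_right: "vir_ev W s a 0 = 0"
  and ev_const_right: "vir_ev W s a (vir_const k * b) = vir_const k * vir_ev W s a b"
  and ev_const_left: "vir_ev W s (vir_const k * a) b = vir_const k * vir_ev W s a b"
  and ev_vir_const_right: "vir_ev W s a (vir_const k) = 0"
  and ev_vir_const_left: "vir_ev W s (vir_const k) a = 0"
  and ev_der_right: "vir_ev W s a (vir_der b) = vir_const s * vir_ev W s a b + vir_der (vir_ev W s a b)"
  and ev_der_left: "vir_ev W s (vir_der a) b = - (vir_const s * vir_ev W s a b)"
  and ev_leibniz: "vir_ev W s a (b * c) = c * vir_ev W s a b + b * vir_ev W s a c"
  by (simp_all add: vir_ev_def add_right add_left const_right const_left der_right der_left
      leibniz poly_theta zero_left zero_right minus_left minus_right vir_const_left vir_const_right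
      diff_left)

lemma additive_ev_right: "additive (vir_ev W s a)"
  by (rule additiveI) (rule ev_add_right)

text \<open>In its last argument the Jacobiator obeys sesquilinearity at \<open>s + t\<close> and
  the Leibniz rule, so vanishing spreads from \<open>L\<close>.\<close>

lemma vir_jacobiator_right:
  assumes L: "vir_jacobiator W s t a b (vir_L 0) = 0"
  shows "vir_jacobiator W s t a b c = 0"
proof -
  have der: "vir_jacobiator W s t a b (vir_der c) = 0" if "vir_jacobiator W s t a b c = 0" for c
  proof -
    have "vir_jacobiator W s t a b (vir_der c) =
        vir_const (s + t) * vir_jacobiator W s t a b c + vir_der (vir_jacobiator W s t a b c)"
      by (simp add: vir_jacobiator_def ev_der_right ev_add_right ev_const_right der.diff der.add
          vir_const_add algebra_simps)
    with that show ?thesis by (simp add: der.zero)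
  qed
  have gen: "vir_jacobiator W s t a b (vir_L n) = 0" for n
    by (induction n) (use L der in \<open>auto simp flip: vir_der_L\<close>)
  show ?thesis
  proof (induction c rule: vir_induct)
    case (const k)
    then show ?case by (simp add: vir_jacobiator_def ev_vir_const_right ev_zero_right)
  next
    case (gen n)
    then show ?case by fact
  next
    case (add f g)
    have "vir_jacobiator W s t a b (f + g) =
        vir_jacobiator W s t a b f + vir_jacobiator W s t a b g"
      by (simp add: vir_jacobiator_def ev_add_right algebra_simps)
    with add show ?case by simp
  next
    case (mult f g)
    have "vir_jacobiator W s t a b (f * g) =
        g * vir_jacobiator W s t a b f + f * vir_jacobiator W s t a b g"
      by (simp add: vir_jacobiator_def ev_add_right ev_leibniz algebra_simps)
    with mult show ?case by simp
  qed
qed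

text \<open>In the first slot of a bracket at \<open>s + t\<close>, \<open>\<partial>\<close> acts
  as \<open>-(s + t)\<close>, hence \<open>-s - \<partial>\<close> acts as \<open>t\<close>.\<close>

lemma ev_subst_skew:
  "vir_ev W (s + t) (poly (subst_skew vir_der p) (vir_const s)) c =
     vir_ev W (s + t) (poly p (vir_const t)) c"
  by (induction p)
    (simp_all add: subst_skew_0 subst_skew_pCons der_additive poly_theta ev_diff_left ev_add_left
      ev_const_left ev_der_left vir_const_add algebra_simps)

lemma vir_jacobiator_swap: "vir_jacobiator W s t a b c = - vir_jacobiator W t s b a c"
proof -
  have "vir_ev W (s + t) (vir_ev W s a b) c = - vir_ev W (s + t) (vir_ev W t b a) c"
    using ev_subst_skew[of s t "W b a" c] skew[of a b] by (simp add: vir_ev_def minus_left)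
  then show ?thesis
    by (simp add: vir_jacobiator_def add.commute)
qed

lemma poly_map_poly_ev: "poly (map_poly (vir_ev W s a) q) (vir_const t) = vir_ev W s a (poly q (vir_const t))"
  by (induction q)
    (simp_all add: ev_zero_right ev_add_right ev_const_right map_poly_additive_pCons additive_ev_right)

text \<open>With \<open>\<lambda>\<close> specialised to \<open>s\<close>, the substitution \<open>\<mu> \<mapsto> - s - \<mu> - \<partial>\<close> permutes the three terms
  of the Jacobi identity up to sign, exchanging the second and the third argument.\<close>

lemma vir_jacobiator_rotate:
  assumes J: "\<And>t. vir_jacobiator W s t a c b = 0"
  shows "vir_jacobiator W s t a b c = 0"
proof -
  \<comment> \<open>With \<open>d = \<partial> + s\<close>, \<open>subst_skew d\<close> is the
    substitution \<open>\<mu> \<mapsto> -s - \<mu> - \<partial>\<close>.\<close>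
  define d where "d x = vir_der x + vir_const s * x" for x :: "'a vir"
  have d: "additive d" by (rule additiveI) (simp add: d_def der.add algebra_simps)
  \<comment> \<open>Translation of \<open>\<mu>\<close> by \<open>s\<close>, for the third term,
    whose bracket is taken at \<open>s + \<mu>\<close>.\<close>
  define shift where "shift p = pcompose p [:vir_const s, 1:]" for p :: "'a vir poly"
  have theta_d: "theta d p = theta vir_der p + smult (vir_const s) p" for p
    by (intro poly_eqI) (simp add: coeff_theta d der_additive d_def)
  have scale: "subst_skew d (smult (vir_const s) p) = smult (vir_const s) (subst_skew d p)" for p
  proof -
    have "additive (vir_scale s)" by (rule additiveI) (simp add: vir.scale_right_distrib)
    then show ?thesis
      using map_poly_subst_skew[of "vir_scale s" d d p]
      by (simp add: d map_poly_vir_scale vir_scale_def d_def der.const_mult distrib_left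
          mult.left_commute)
  qed
  have shift: "subst_skew d (shift p) = subst_skew vir_der p" for p
  proof (induction p)
    case 0
    then show ?case by (simp add: shift_def subst_skew_0 d der_additive)
  next
    case (pCons x p)
    have "shift (pCons x p) = [:x:] + smult (vir_const s) (shift p) + pCons 0 (shift p)"
      by (simp add: shift_def pcompose_pCons)
    then show ?case
      by (simp add: subst_skew_add d subst_skew_const scale subst_skew_pCons_0 subst_skew_pCons
          der_additive pCons.IH theta_d subst_skew_0 theta_0)
  qed
  have shift': "subst_skew d (subst_skew vir_der p) = shift p" for p
    by (simp add: subst_skew_involution d flip: shift)
  \<comment> \<open>By sesquilinearity the bracket with \<open>a\<close> at \<open>s\<close>
    intertwines \<open>\<partial>\<close> with \<open>d\<close>.\<close>
  have ev: "subst_skew d (map_poly (vir_ev W s a) p) = map_poly (vir_ev W s a) (subst_skew vir_der p)" for p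
    by (rule map_poly_subst_skew[symmetric])
      (simp_all add: d der_additive additive_ev_right ev_der_right d_def)
  have eval: "poly (map_poly (vir_ev W s a) (W x y) - W x (vir_ev W s a y) - shift (W (vir_ev W s a x) y))
      (vir_const t) = vir_jacobiator W s t a x y" for x y t
    by (simp add: poly_map_poly_ev vir_jacobiator_def shift_def poly_pcompose vir_const_add)
      (simp add: vir_ev_def vir_const_add)
  have "map_poly (vir_ev W s a) (W c b) - W c (vir_ev W s a b) - shift (W (vir_ev W s a c) b) = 0"
    by (rule vir_const_poly_eqI) (simp only: eval J poly_0)
  then have "subst_skew d (map_poly (vir_ev W s a) (W c b) - W c (vir_ev W s a b)
      - shift (W (vir_ev W s a c) b)) = 0"
    by (simp add: subst_skew_0 d)
  also have "subst_skew d (map_poly (vir_ev W s a) (W c b) - W c (vir_ev W s a b)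
      - shift (W (vir_ev W s a c) b)) =
      - (map_poly (vir_ev W s a) (W b c) - W b (vir_ev W s a c) - shift (W (vir_ev W s a b) c))"
  proof -
    have "subst_skew d (W c (vir_ev W s a b)) = - shift (W (vir_ev W s a b) c)"
      by (subst skew) (simp add: subst_skew_minus d shift')
    then show ?thesis
      using skew[of b c] skew[of b "vir_ev W s a c"]
      by (simp add: subst_skew_diff d ev shift map_poly_minus additive_ev_right)
  qed
  finally show ?thesis using eval[of b c t] by simp
qed

text \<open>Only the last slot extends directly from \<open>L\<close>; rotation and swap bring the
  other two there in turn.\<close>

lemma vir_jacobiator_extend:
  assumes "\<And>s t. vir_jacobiator W s t (vir_L 0) (vir_L 0) (vir_L 0) = 0"
  shows "vir_jacobiator W s t a b c = 0"
proof -
  have "vir_jacobiator W s t (vir_L 0) (vir_L 0) c = 0" for s t c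
    by (rule vir_jacobiator_right) (rule assms)
  then have "vir_jacobiator W s t (vir_L 0) b (vir_L 0) = 0" for s t b
    by (rule vir_jacobiator_rotate)
  then have "vir_jacobiator W s t (vir_L 0) b c = 0" for s t b c
    by (rule vir_jacobiator_right)
  then have "vir_jacobiator W s t a (vir_L 0) c = 0" for s t a c
    by (subst vir_jacobiator_swap) simp
  then have "vir_jacobiator W s t a b (vir_L 0) = 0" for s t a b
    by (rule vir_jacobiator_rotate)
  then show ?thesis by (rule vir_jacobiator_right)
qed

lemma eval2_vir_jacobiator:
  "eval2 (vir_const s) (vir_const t) (pva_jacobiator W a b c) = vir_jacobiator W s t a b c"
  using eval2_pva_jacobiator[of W "vir_const s" "vir_const t" a b c]
  by (simp add: additive_left additive_right bracket_constant_vir_const vir_jacobiator_def vir_ev_def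
      vir_const_add)

lemma pva_jacobiator_eq_0_iff:
  "pva_jacobiator W a b c = 0 \<longleftrightarrow> (\<forall>s t. vir_jacobiator W s t a b c = 0)"
proof
  assume "pva_jacobiator W a b c = 0"
  then show "\<forall>s t. vir_jacobiator W s t a b c = 0"
    by (simp add: eval2_def flip: eval2_vir_jacobiator)
next
  assume J: "\<forall>s t. vir_jacobiator W s t a b c = 0"
  show "pva_jacobiator W a b c = 0"
  proof (rule eval2_eq_0D[of "range vir_const"])
    show "p = 0" if "\<And>x. x \<in> range vir_const \<Longrightarrow> poly p x = 0" for p :: "'a vir poly"
      by (rule vir_const_poly_eqI) (simp add: that)
  qed (auto simp: eval2_vir_jacobiator J)
qed

end

lemma pva_vir_iff:
  "pva vir_scale vir_der W \<longleftrightarrow>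
     vir_skew W \<and> (\<forall>s t a b c. vir_jacobiator W s t a b c = 0)"
proof
  assume "pva vir_scale vir_der W"
  then interpret pva vir_scale vir_der W .
  have one: "W a 1 = 0" for a
    using leibniz[of a 1 1] by simp
  have "W a (vir_const k) = 0" for a k
    using br_scale_right[of a k 1] by (simp add: one vir_scale_def)
  then have const: "W a (vir_const k * b) = smult (vir_const k) (W a b)" for a b k
    by (simp add: leibniz)
  have "vir_skew W"
    by (unfold_locales; (rule skew_symmetry)?)
      (simp_all add: br_add_right const sesquilinear_right theta_def, rule leibniz)
  then interpret vir_skew W .
  have "pva_jacobiator W a b c = 0" for a b c
    using jacobi[of a b c] by (simp add: pva_jacobiator_def)
  with \<open>vir_skew W\<close> show "vir_skew W \<and> (\<forall>s t a b c. vir_jacobiator W s t a b c = 0)"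
    by (simp add: pva_jacobiator_eq_0_iff)
next
  assume W: "vir_skew W \<and> (\<forall>s t a b c. vir_jacobiator W s t a b c = 0)"
  then interpret vir_skew W by simp
  have J: "pva_jacobiator W a b c = 0" for a b c
    using W by (simp add: pva_jacobiator_eq_0_iff)
  show "pva vir_scale vir_der W"
  proof
    show "alg_derivation vir_scale vir_der"
      by (simp add: alg_derivation_iff_vir_derivation der.vir_derivation_axioms)
    show "W a b = - subst_skew vir_der (W b a)" for a b by (rule skew)
  qed (use J[unfolded pva_jacobiator_def] in \<open>simp_all add: add_left add_right map_poly_vir_scale
      vir_scale_def const_left const_right vir_const_right der_left der_right leibniz theta_def mult.assoc\<close>)
qed

section \<open>Existence and uniqueness of the Virasoro bracket\<close>

definition virasoro_op :: "'a::field_char_0 \<Rightarrow> 'a vir poly" where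
  "virasoro_op \<kappa> = [:vir_L 1, 2 * vir_L 0, 0, vir_const \<kappa>:]"

lemma subst_skew_virasoro_op:
  fixes \<kappa> :: "'a::field_char_0"
  shows "subst_skew vir_der (virasoro_op \<kappa>) = - virasoro_op \<kappa>"
  using der.const_mult[of "2::'a" "vir_L 0"]
  by (simp add: virasoro_op_def subst_skew_0 subst_skew_pCons der_additive theta_def
      map_poly_additive_pCons der.const der.zero der.minus der.diff vir_der_L vir_const_numeral)

lemma vir_skew_virasoro: "vir_skew (vir_op_bracket (virasoro_op \<kappa>))"
  by (rule vir_skew_op_bracket) (rule subst_skew_virasoro_op)

lemma vir_jacobiator_virasoro:
  "vir_jacobiator (vir_op_bracket (virasoro_op \<kappa>)) s t a b c = 0"
proof -
  interpret vir_skew "vir_op_bracket (virasoro_op \<kappa>)" by (rule vir_skew_virasoro)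
  let ?W = "vir_op_bracket (virasoro_op \<kappa>)"
  have LL: "vir_ev ?W s (vir_L 0) (vir_L 0) =
      vir_der (vir_L 0) + vir_const (2 * s) * vir_L 0 + vir_const (\<kappa> * s ^ 3)" for s
    by (simp add: vir_ev_def vir_op_bracket_L virasoro_op_def vir_const_mult vir_const_numeral
        vir_const_power vir_der_L power3_eq_cube algebra_simps)
  have "vir_jacobiator ?W s t (vir_L 0) (vir_L 0) (vir_L 0) = 0" for s t
    unfolding vir_jacobiator_def LL
    by (simp add: ev_add_left ev_add_right ev_der_left ev_der_right ev_const_left ev_const_right
        ev_vir_const_left ev_vir_const_right LL der.add der.const der.const_mult)
      (simp add: vir_const_mult vir_const_add vir_const_numeral vir_const_power algebra_simps
        power3_eq_cube)
  then show ?thesis by (rule vir_jacobiator_extend)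
qed

text \<open>\<open>THE\<close> needs existence, from the master formula and the Jacobi identity, and
  uniqueness, from \<open>vir_skew_eqI\<close>.\<close>

lemma vir_bracket_eq: "vir_bracket c = vir_op_bracket (virasoro_op (c / 12))"
  unfolding vir_bracket_def
proof (rule the_equality)
  show "pva vir_scale vir_der (vir_op_bracket (virasoro_op (c / 12))) \<and>
    vir_op_bracket (virasoro_op (c / 12)) (vir_L 0) (vir_L 0) =
      [:vir_L 1, 2 * vir_L 0, 0, vir_const (c / 12):]"
    by (simp add: pva_vir_iff vir_skew_virasoro vir_jacobiator_virasoro vir_op_bracket_L)
      (simp add: virasoro_op_def)
next
  fix br :: "'a vir \<Rightarrow> 'a vir \<Rightarrow> 'a vir poly"
  assume br: "pva vir_scale vir_der br \<and>
    br (vir_L 0) (vir_L 0) = [:vir_L 1, 2 * vir_L 0, 0, vir_const (c / 12):]"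
  show "br = vir_op_bracket (virasoro_op (c / 12))"
  proof (intro ext)
    show "br a b = vir_op_bracket (virasoro_op (c / 12)) a b" for a b
      by (rule vir_skew_eqI[OF _ vir_skew_virasoro])
        (use br in \<open>simp_all add: pva_vir_iff vir_op_bracket_L\<close>, simp add: virasoro_op_def)
  qed
qed

section \<open>Casimir elements and derivations\<close>

text \<open>\<open>U\<close> is the outer and \<open>V\<close> the inner bracket. The
  \<epsilon>-part of the Jacobi identity of \<open>W + \<epsilon> Z\<close> is the sum of the two
  mixed expressions in \<open>W\<close> and \<open>Z\<close>.\<close>

definition vir_jac_mixed ::
  "('a::field_char_0 vir \<Rightarrow> 'a vir \<Rightarrow> 'a vir poly) \<Rightarrow> ('a vir \<Rightarrow> 'a vir \<Rightarrow> 'a vir poly) \<Rightarrow>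
     'a \<Rightarrow> 'a \<Rightarrow> 'a vir \<Rightarrow> 'a vir \<Rightarrow> 'a vir \<Rightarrow> 'a vir" where
  "vir_jac_mixed U V s t a b c =
    vir_ev U s a (vir_ev V t b c) - vir_ev U t b (vir_ev V s a c)
      - vir_ev U (s + t) (vir_ev V s a b) c"

lemma vir_jacobiator_eq_mixed: "vir_jacobiator W = vir_jac_mixed W W"
  by (simp add: fun_eq_iff vir_jacobiator_def vir_jac_mixed_def)

text \<open>Only \<open>\<mu>\<close> is specialised, to \<open>t\<close>, so that coefficients of
  powers of \<open>\<lambda>\<close> can be compared.\<close>

definition vir_jac_poly ::
  "('a::field_char_0 vir \<Rightarrow> 'a vir \<Rightarrow> 'a vir poly) \<Rightarrow> ('a vir \<Rightarrow> 'a vir \<Rightarrow> 'a vir poly) \<Rightarrow>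
     'a \<Rightarrow> 'a vir \<Rightarrow> 'a vir \<Rightarrow> 'a vir \<Rightarrow> 'a vir poly" where
  "vir_jac_poly U V t a b c =
    U a (vir_ev V t b c) - map_poly (vir_ev U t b) (V a c)
      - (\<Sum>i\<le>degree (V a b). monom 1 i * pcompose (U (coeff (V a b) i) c) [:vir_const t, 1:])"

lemma poly_vir_jac_poly:
  assumes "vir_skew U"
  shows "poly (vir_jac_poly U V t a b c) (vir_const s) = vir_jac_mixed U V s t a b c"
proof -
  interpret U: vir_skew U by fact
  have "(\<Sum>i\<le>degree (V a b). vir_const s ^ i * poly (U (coeff (V a b) i) c) (vir_const (s + t))) =
      vir_ev U (s + t) (vir_ev V s a b) c"
    unfolding vir_ev_def by (rule poly_linear_poly) (simp_all add: U.additive_left U.const_left)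
  then show ?thesis
    by (simp add: vir_jac_poly_def vir_jac_mixed_def poly_sum poly_monom poly_pcompose U.poly_map_poly_ev
        vir_const_add add.commute)
      (simp add: vir_ev_def)
qed

lemma coeff_pcompose_linear:
  fixes p :: "'v::idom poly"
  shows "coeff (pcompose p [:x, 1:]) 0 = poly p x"
    and "coeff (pcompose p [:x, 1:]) 1 = poly (pderiv p) x"
proof -
  show 0: "coeff (pcompose p [:x, 1:]) 0 = poly p x" for p :: "'v poly"
    by (induction p) (simp_all add: pcompose_pCons coeff_pCons_0)
  show "coeff (pcompose p [:x, 1:]) 1 = poly (pderiv p) x"
    by (induction p) (simp_all add: pcompose_pCons pderiv_pCons 0)
qed

text \<open>Modes 0 and 1 of \<open>a\<close> in the Jacobi identity. The third bracket is taken at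
  \<open>\<lambda> + t\<close>, and its Taylor expansion brings in \<open>pderiv\<close>.\<close>

lemma coeff_vir_jac_poly:
  assumes "vir_skew U"
  shows "coeff (vir_jac_poly U V t a b c) 0 =
      coeff (U a (vir_ev V t b c)) 0 - vir_ev U t b (coeff (V a c) 0)
        - vir_ev U t (coeff (V a b) 0) c"
    and "coeff (vir_jac_poly U V t a b c) 1 =
      coeff (U a (vir_ev V t b c)) 1 - vir_ev U t b (coeff (V a c) 1)
        - (poly (pderiv (U (coeff (V a b) 0) c)) (vir_const t) + vir_ev U t (coeff (V a b) 1) c)"
proof -
  interpret U: vir_skew U by fact
  define q where "q i = pcompose (U (coeff (V a b) i) c) [:vir_const t, 1:]" for i
  have big: "q i = 0" if "degree (V a b) < i" for i
    using that by (simp add: q_def coeff_eq_0 U.zero_left)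
  \<comment> \<open>One further term, equal to 0, so that index 1 occurs even when
    \<open>V a b\<close> is constant in \<open>\<lambda>\<close>.\<close>
  have sum: "(\<Sum>i\<le>degree (V a b). monom 1 i * q i) = (\<Sum>i\<le>Suc (degree (V a b)). monom 1 i * q i)"
    by (simp add: big)
  have split: "coeff (monom 1 i * q i) n = (if i \<le> n then coeff (q i) (n - i) else 0)" for i n
    by (simp add: coeff_monom_mult)
  have "coeff (\<Sum>i\<le>degree (V a b). monom 1 i * q i) 0 = coeff (q 0) 0"
    unfolding sum coeff_sum split by (subst sum.atMost_Suc_shift) simp
  moreover have "coeff (\<Sum>i\<le>degree (V a b). monom 1 i * q i) 1 = coeff (q 0) 1 + coeff (q 1) 0"
    unfolding sum coeff_sum split
    by (subst sum.atMost_Suc_shift)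
      (cases "degree (V a b)", simp_all add: sum.atMost_Suc_shift del: sum.atMost_Suc)
  ultimately show "coeff (vir_jac_poly U V t a b c) 0 =
      coeff (U a (vir_ev V t b c)) 0 - vir_ev U t b (coeff (V a c) 0)
        - vir_ev U t (coeff (V a b) 0) c"
    and "coeff (vir_jac_poly U V t a b c) 1 =
      coeff (U a (vir_ev V t b c)) 1 - vir_ev U t b (coeff (V a c) 1)
        - (poly (pderiv (U (coeff (V a b) 0) c)) (vir_const t) + vir_ev U t (coeff (V a b) 1) c)"
    by (simp_all add: vir_jac_poly_def q_def[symmetric] coeff_map_poly_additive U.additive_ev_right)
      (simp_all add: q_def coeff_pcompose_linear coeff_pcompose_linear(2)[simplified] vir_ev_def)
qed

section \<open>Conformal weight\<close>

abbreviation conf_weight :: "(nat \<Rightarrow>\<^sub>0 nat) \<Rightarrow> nat" where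
  "conf_weight \<equiv> mon_weight (\<lambda>n. n + 2)"

text \<open>These are the resonant weights of the homogeneity equations solved below.\<close>

lemma conf_weight_small:
  "conf_weight m \<noteq> 1"
  "conf_weight m = 0 \<longleftrightarrow> m = 0"
  "conf_weight m = 2 \<longleftrightarrow> m = msingle 0 1"
  "conf_weight m = 3 \<longleftrightarrow> m = msingle 1 1"
proof -
  show 0: "conf_weight m = 0 \<longleftrightarrow> m = 0" for m by (rule mon_weight_eq_0_iff) simp
  have split: "\<exists>n l. m = l + msingle n 1 \<and> conf_weight m = conf_weight l + n + 2" if "m \<noteq> 0" for m
    using that
    by (rule poly_mapping_split_single) (auto simp: mon_weight_add mon_weight_single)
  show 1: "conf_weight m \<noteq> 1" for m
    using split[of m] 0[of m] by (cases "m = 0") auto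
  show "conf_weight m = 2 \<longleftrightarrow> m = msingle 0 1"
  proof
    assume "conf_weight m = 2"
    then obtain n l where "m = l + msingle n 1" "conf_weight l = 0" "n = 0"
      using split[of m] 0[of m] by fastforce
    then show "m = msingle 0 1" using 0[of l] by simp
  qed (simp add: mon_weight_single)
  show "conf_weight m = 3 \<longleftrightarrow> m = msingle 1 1"
  proof
    assume "conf_weight m = 3"
    then obtain n l where m: "m = l + msingle n 1" "conf_weight l + n = 1"
      using split[of m] 0[of m] by fastforce
    then have "conf_weight l = 0" "n = 1" using 1[of l] by linarith+
    then show "m = msingle 1 1" using m 0[of l] by simp
  qed (simp add: mon_weight_single)
qed

definition vir_wt :: "'a::field_char_0 vir \<Rightarrow> 'a vir" where
  "vir_wt = vir_diag (\<lambda>m. of_nat (conf_weight m))"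

lemma lookup_vir_wt: "mlookup (vir_wt f) m = of_nat (conf_weight m) * mlookup f m"
  by (simp add: vir_wt_def lookup_vir_diag)

lemma vir_wt_eq_evo: "vir_wt f = vir_evo (\<lambda>n. of_nat (n + 2) * vir_L n) f"
  by (simp only: vir_wt_def vir_evo_weight)

interpretation wt: vir_derivation vir_wt
  using vir_derivation_evo[of "\<lambda>n. of_nat (n + 2) * vir_L n"] by (simp only: vir_wt_eq_evo[abs_def])

lemma vir_wt_L: "vir_wt (vir_L n) = of_nat (n + 2) * vir_L n"
  by (simp only: vir_wt_eq_evo vir_evo_L)

lemma vir_wt_eq_2:
  assumes "vir_wt f = 2 * f"
  shows "f = vir_const (mlookup f (msingle 0 1)) * vir_L 0"
proof (intro poly_mapping_eqI)
  fix m
  have "of_nat (conf_weight m) * mlookup f m = 2 * mlookup f m"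
    using assms lookup_vir_wt[of f m] lookup_vir_const_mult[of 2 f m] by (simp add: vir_const_numeral)
  then have "(of_nat (conf_weight m) - of_nat 2) * mlookup f m = 0" by (simp add: algebra_simps)
  then have "m = msingle 0 1 \<or> mlookup f m = 0"
    unfolding mult_eq_0_iff right_minus_eq of_nat_eq_iff conf_weight_small(3) .
  then show "mlookup f m = mlookup (vir_const (mlookup f (msingle 0 1)) * vir_L 0) m"
    by (auto simp: lookup_vir_const_mult vir_L_def lookup_single when_def)
qed

section \<open>Modes of the Virasoro bracket, Casimir elements and inner derivations\<close>

locale virasoro_pva = vir_skew W
  for W :: "'a::field_char_0 vir \<Rightarrow> 'a vir \<Rightarrow> 'a vir poly" +
  fixes \<kappa> :: 'a
  assumes LL: "W (vir_L 0) (vir_L 0) = virasoro_op \<kappa>"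
    and jac: "vir_jacobiator W s t a b c = 0"
begin

lemma coeff_LL:
  "coeff (W (vir_L 0) (vir_L 0)) 0 = vir_L 1"
  "coeff (W (vir_L 0) (vir_L 0)) 1 = 2 * vir_L 0"
  by (simp_all add: LL virasoro_op_def)

definition ad :: "'a vir \<Rightarrow> 'a vir \<Rightarrow> 'a vir" where
  "ad a b = coeff (W a b) 0"

lemma ad_eq_poly: "ad a b = poly (W a b) 0"
  by (simp add: ad_def poly_0_coeff_0)

lemma ad_eq_ev: "ad a b = vir_ev W 0 a b"
  by (simp add: ad_eq_poly vir_ev_def)

lemma vir_derivation_ad: "vir_derivation (ad a)"
  by (rule vir_derivationI)
    (simp_all add: ad_def add_right leibniz vir_const_right mult.commute add.commute)

lemma ad_der: "ad a (vir_der b) = vir_der (ad a b)"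
  by (simp add: ad_def der_right coeff_theta der_additive)

lemma ad_L: "ad (vir_L 0) b = vir_der b"
  by (rule vir_derivation_evolutionary_eqI[OF vir_derivation_ad ad_der der.vir_derivation_axioms])
    (simp_all add: ad_def coeff_LL[simplified] vir_der_L)

text \<open>Passing from \<open>b\<close> to \<open>\<partial>b\<close> adds mode 0 of
  \<open>L\<close>, which is \<open>\<partial>\<close>; so each derivative raises the eigenvalue by
  one, starting from 2 at \<open>L\<close>.\<close>

lemma coeff_1_L: "coeff (W (vir_L 0) b) 1 = vir_wt b"
proof (rule vir_derivation_eqI[OF _ wt.vir_derivation_axioms])
  show "vir_derivation (\<lambda>b. coeff (W (vir_L 0) b) 1)"
    by (rule vir_derivationI)
      (simp_all add: add_right leibniz vir_const_right mult.commute add.commute)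
  have "coeff (W (vir_L 0) (vir_der b)) 1 = vir_der b + vir_der (coeff (W (vir_L 0) b) 1)" for b
    using ad_L[of b] by (simp add: der_right coeff_theta der_additive ad_def)
  note step = this[of "vir_L _", unfolded vir_der_L]
  show "coeff (W (vir_L 0) (vir_L n)) 1 = vir_wt (vir_L n)" for n
  proof (induction n)
    case 0
    then show ?case by (simp add: coeff_LL[simplified] vir_wt_L)
  next
    case (Suc n)
    have "vir_der (of_nat (n + 2) * vir_L n) = of_nat (n + 2) * vir_L (Suc n)"
      using der.const_mult[of "of_nat (n + 2)" "vir_L n"] by (simp only: vir_const_of_nat vir_der_L)
    then show ?case unfolding step Suc.IH vir_wt_L by (simp add: algebra_simps)
  qed
qed

text \<open>At \<open>\<lambda> = 0\<close> the master formula gives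
  \<open>L' + 2L\<partial> + \<kappa>\<partial>^3\<close> applied to \<open>\<delta>a\<close>, so
  injectivity forces \<open>\<delta>a = 0\<close>.\<close>

lemma ad_eq_0_imp:
  assumes "ad a (vir_L 0) = 0"
  obtains k g where "a = vir_const k + vir_der g"
proof -
  have W: "W a = vir_op_bracket (virasoro_op \<kappa>) a"
    by (rule ext, rule vir_skew_eqI[OF vir_skew_axioms vir_skew_virasoro])
      (simp add: LL vir_op_bracket_L)
  have "ad a (vir_L 0) = poly (star vir_der (virasoro_op \<kappa>) [:vir_delta a:]) 0"
    using poly_0_star[OF der_additive, of "virasoro_op \<kappa>" "subst_skew vir_der (vir_frechet a)"]
    by (simp add: ad_eq_poly W vir_op_bracket_def vir_frechet_L monom_0 star_const vir_delta_def)
  also have "\<dots> = vir_L 1 * vir_delta a + 2 * vir_L 0 * vir_der (vir_delta a) +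
      vir_const \<kappa> * vir_der (vir_der (vir_der (vir_delta a)))"
    by (simp add: virasoro_op_def poly_0_star_pCons)
  finally have "vir_delta a = 0" using assms virasoro_operator_injective by metis
  then show thesis using that by (rule vir_delta_eq_0)
qed

lemma jac_poly_eq_0: "vir_jac_poly W W t a b c = 0"
  by (rule vir_const_poly_eqI)
    (simp add: poly_vir_jac_poly vir_skew_axioms jac flip: vir_jacobiator_eq_mixed)

lemma ad_ev: "ad a (vir_ev W t b c) = vir_ev W t (ad a b) c + vir_ev W t b (ad a c)"
  using coeff_vir_jac_poly(1)[OF vir_skew_axioms, of W t a b c]
  by (simp add: jac_poly_eq_0 ad_def algebra_simps)

lemma pderiv_der_left:
  "poly (pderiv (W (vir_der b) c)) (vir_const t) =
    - (vir_ev W t b c + vir_const t * poly (pderiv (W b c)) (vir_const t))"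
  by (simp add: der_left pderiv_minus pderiv_pCons vir_ev_def)

text \<open>Mode 1 of the Jacobi identity at \<open>L\<close>: the bracket lowers the weight by one,
  and each power of \<open>\<lambda>\<close> by one more.\<close>

lemma wt_ev: "vir_wt (vir_ev W t b c) = vir_ev W t (vir_wt b) c + vir_ev W t b (vir_wt c)
    - (vir_ev W t b c + vir_const t * poly (pderiv (W b c)) (vir_const t))"
  using coeff_vir_jac_poly(2)[OF vir_skew_axioms, of W t "vir_L 0" b c] ad_L[of b]
  by (simp add: jac_poly_eq_0 coeff_1_L[simplified] ad_def pderiv_der_left algebra_simps)

lemma wt_ad: "vir_wt (ad b c) = ad (vir_wt b) c + ad b (vir_wt c) - ad b c"
  using wt_ev[of 0 b c] by (simp add: ad_eq_ev)

lemma derivation_inner: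
  assumes D: "vir_derivation D" and comm: "\<And>f. D (vir_der f) = vir_der (D f)"
    and br: "\<And>b. map_poly D (W (vir_L 0) b) = W (D (vir_L 0)) b + W (vir_L 0) (D b)"
  shows "\<exists>a. \<forall>b. D b = ad a b"
proof -
  interpret D: vir_derivation D by fact
  define f where "f = D (vir_L 0)"
  have br': "D (coeff (W (vir_L 0) b) n) = coeff (W f b) n + coeff (W (vir_L 0) (D b)) n" for b n
    using arg_cong[OF br[of b], of "\<lambda>p. coeff p n"]
    by (simp add: coeff_map_poly_additive D.additive_axioms f_def)
  \<comment> \<open>Mode 0 of \<open>L\<close> is \<open>\<partial>\<close>, which commutes with
    \<open>D\<close>, so only the bracket with \<open>f\<close> remains.\<close>
  have casimir: "ad f b = 0" for b
    using br'[of b 0] by (simp add: ad_L[unfolded ad_def] ad_def comm)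
  then obtain k g where f: "f = vir_const k + vir_der g" using ad_eq_0_imp by blast
  \<comment> \<open>Sesquilinearity turns \<open>\<partial>\<close> on \<open>g\<close> into
    \<open>-\<lambda>\<close>, moving mode 0 of \<open>g\<close> to mode 1 of
    \<open>f\<close>.\<close>
  have "coeff (W f b) 1 = - ad g b" for b
    by (simp add: f add_left vir_const_left der_left ad_def)
  then have wt_f: "vir_wt f = 2 * f + ad g (vir_L 0)"
    using br'[of "vir_L 0" 1] D.const_mult[of 2 "vir_L 0"]
    by (simp add: coeff_1_L[simplified] vir_wt_L vir_const_numeral f_def[symmetric] algebra_simps)
  \<comment> \<open>The solution of \<open>vir_wt a - a = g\<close>; the denominators are nonzero
    because no monomial has weight 1.\<close>
  define a where "a = vir_diag (\<lambda>m. inverse (of_nat (conf_weight m) - 1)) g"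
  have wt_a: "vir_wt a = a + g"
  proof (intro poly_mapping_eqI)
    fix m
    have "of_nat (conf_weight m) - (1::'a) \<noteq> 0"
      using conf_weight_small(1)[of m] of_nat_eq_iff[of "conf_weight m" 1, where 'a = 'a] by simp
    then show "mlookup (vir_wt a) m = mlookup (a + g) m"
      by (simp add: lookup_add lookup_vir_wt a_def lookup_vir_diag field_simps)
  qed
  \<comment> \<open>\<open>h\<close> obeys the same weight equation as \<open>f\<close>, so
    \<open>f - h\<close> has weight 2 and is a multiple of \<open>L\<close>.\<close>
  define h where "h = ad a (vir_L 0)"
  have "vir_wt h = ad g (vir_L 0) + 2 * h"
    using wt_ad[of a "vir_L 0"] vir_derivation.const_mult[OF vir_derivation_ad, of a 2 "vir_L 0"]
    by (simp add: h_def wt_a vir_wt_L vir_const_numeral ad_eq_ev ev_add_left)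
  then have "vir_wt (f - h) = 2 * (f - h)" by (simp add: wt.diff wt_f algebra_simps)
  then obtain j where j: "f - h = vir_const j * vir_L 0" using vir_wt_eq_2 by blast
  \<comment> \<open>\<open>ad h\<close> is the commutator of \<open>ad a\<close> with
    \<open>ad L = \<partial>\<close>, so \<open>f - h\<close> is a Casimir element as well.\<close>
  have "ad h b = 0" for b
    using ad_ev[of a 0 "vir_L 0" b] ad_L ad_der by (simp add: h_def flip: ad_eq_ev)
  then have "ad (f - h) (vir_L 0) = 0"
    using casimir by (simp add: ad_eq_ev ev_diff_left)
  then have "vir_const j * vir_L 1 = 0"
    unfolding j by (simp add: ad_def const_left coeff_LL[simplified])
  moreover have "vir_L 1 \<noteq> (0 :: 'a vir)"
    by (metis vir_L_def lookup_single_eq lookup_zero zero_neq_one)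
  ultimately have "f = h" using j by simp
  have "D b = ad a b" for b
    by (rule vir_derivation_evolutionary_eqI[OF D comm vir_derivation_ad ad_der])
      (use \<open>f = h\<close> in \<open>simp add: f_def h_def\<close>)
  then show ?thesis by blast
qed

end

lemma virasoro_pva_vir_bracket: "virasoro_pva (vir_bracket c) (c / 12)"
  unfolding vir_bracket_eq virasoro_pva_def virasoro_pva_axioms_def
  by (simp add: vir_skew_virasoro vir_jacobiator_virasoro vir_op_bracket_L)

lemma virasoro_casimir:
  assumes "casimir vir_der (vir_bracket c) X"
  shows "\<exists>k. X = loc_func vir_der (vir_scale k 1)"
proof -
  interpret virasoro_pva "vir_bracket c" "c / 12" by (rule virasoro_pva_vir_bracket)
  obtain a where X: "X = loc_func vir_der a" and a: "\<And>b. poly (vir_bracket c a b) 0 = 0"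
    using assms by (auto simp: casimir_def)
  obtain k g where kg: "a = vir_const k + vir_der g"
    using a by (rule ad_eq_0_imp[unfolded ad_eq_poly])
  have "loc_func vir_der a = loc_func vir_der (vir_const k)"
  proof (intro set_eqI iffI)
    fix x assume "x \<in> loc_func vir_der a"
    then obtain v where "x = a + vir_der v" by (auto simp: loc_func_def)
    then have "x = vir_const k + vir_der (g + v)" by (simp add: kg der.add)
    then show "x \<in> loc_func vir_der (vir_const k)" by (auto simp: loc_func_def)
  next
    fix x assume "x \<in> loc_func vir_der (vir_const k)"
    then obtain v where "x = vir_const k + vir_der v" by (auto simp: loc_func_def)
    then have "x = a + vir_der (v - g)" by (simp add: kg der.diff)
    then show "x \<in> loc_func vir_der a" by (auto simp: loc_func_def)
  qed
  then show ?thesis by (auto simp: X vir_scale_def)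
qed

lemma virasoro_derivation_inner:
  assumes "pva_derivation vir_scale vir_der (vir_bracket c) D"
  shows "inner_derivation (vir_bracket c) D"
proof -
  interpret virasoro_pva "vir_bracket c" "c / 12" by (rule virasoro_pva_vir_bracket)
  have "\<exists>a. \<forall>b. D b = ad a b"
    by (rule derivation_inner)
      (use assms in \<open>simp_all add: pva_derivation_def alg_derivation_iff_vir_derivation\<close>)
  then show ?thesis by (simp add: inner_derivation_def ad_eq_poly)
qed

section \<open>First-order deformations\<close>

lemma dual_sel_simps [simp]:
  "std (0 :: 'v::comm_ring_1 dual) = 0" "eps (0 :: 'v dual) = 0"
  "std (1 :: 'v dual) = 1" "eps (1 :: 'v dual) = 0"
  "std (x + y) = std x + std (y :: 'v dual)" "eps (x + y) = eps x + eps (y :: 'v dual)"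
  "std (x - y) = std x - std (y :: 'v dual)" "eps (x - y) = eps x - eps (y :: 'v dual)"
  "std (- x) = - std (x :: 'v dual)" "eps (- x) = - eps (x :: 'v dual)"
  "std (x * y) = std x * std (y :: 'v dual)"
  "eps (x * y) = std x * eps y + eps x * std (y :: 'v dual)"
  by (simp_all add: zero_dual_def one_dual_def plus_dual_def minus_dual_def uminus_dual_def
      times_dual_def)

lemma additive_dual:
  "additive (std :: 'v::comm_ring_1 dual \<Rightarrow> 'v)" "additive (eps :: 'v dual \<Rightarrow> 'v)"
  "additive (\<lambda>v::'v. Dual v 0)" "additive (\<lambda>v::'v. Dual 0 v)"
  by (auto intro!: additiveI simp: plus_dual_def)

lemma dual_eq_iff: "x = y \<longleftrightarrow> std x = std y \<and> eps x = eps y"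
  by (cases x; cases y) simp

lemma dual_poly_eq_iff:
  "p = q \<longleftrightarrow> map_poly std p = map_poly std q \<and> map_poly eps p = map_poly eps q"
  for p q :: "'v::comm_ring_1 dual poly"
  by (auto simp: poly_eq_iff coeff_map_poly dual_eq_iff)

lemma map_poly_dual_simps [simp]:
  fixes p q :: "'v::comm_ring_1 dual poly"
  shows "map_poly std (p + q) = map_poly std p + map_poly std q"
    "map_poly eps (p + q) = map_poly eps p + map_poly eps q"
    "map_poly std (- p) = - map_poly std p"
    "map_poly eps (- p) = - map_poly eps p"
    "map_poly std (pCons x p) = pCons (std x) (map_poly std p)"
    "map_poly eps (pCons x p) = pCons (eps x) (map_poly eps p)"
    "map_poly std (smult x p) = smult (std x) (map_poly std p)"
    "map_poly eps (smult x p) = smult (std x) (map_poly eps p) + smult (eps x) (map_poly std p)"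
  by (intro poly_eqI; simp add: coeff_map_poly coeff_pCons split: nat.split)+

lemma map_poly_dual_der:
  assumes "additive d"
  shows "map_poly std (map_poly (dual_der d) p) = map_poly d (map_poly std p)"
    and "map_poly eps (map_poly (dual_der d) p) = map_poly d (map_poly eps p)"
  by (intro poly_eqI; simp add: coeff_map_poly dual_der_def additive.zero[OF assms]
      zero_dual_def[symmetric])+

lemma additive_dual_der: "additive d \<Longrightarrow> additive (dual_der d)"
  by (rule additiveI) (simp add: dual_der_def dual_eq_iff additive.add)

lemma map_poly_dual_subst_skew:
  assumes "additive d"
  shows "map_poly std (subst_skew (dual_der d) p) = subst_skew d (map_poly std p)"
    and "map_poly eps (subst_skew (dual_der d) p) = subst_skew d (map_poly eps p)"
  by (rule map_poly_subst_skew;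
      simp add: additive_dual additive_dual_der assms dual_der_def)+

lemma map_poly_dual_br:
  "map_poly std (dual_br W Z x y) = W (std x) (std y)"
  "map_poly eps (dual_br W Z x y) =
     Z (std x) (std y) + W (eps x) (std y) + W (std x) (eps y)"
  by (intro poly_eqI; simp add: dual_br_def coeff_map_poly zero_dual_def[symmetric])+

lemma poly_Dual:
  "poly p (Dual x 0) = Dual (poly (map_poly std p) x) (poly (map_poly eps p) x)"
  by (induction p) (simp_all add: dual_eq_iff mult.commute)

definition vir_dual_const :: "'a::field_char_0 dual \<Rightarrow> 'a vir dual" where
  "vir_dual_const r = Dual (vir_const (std r)) (vir_const (eps r))"

lemma dual_scale_vir: "dual_scale vir_scale r x = vir_dual_const r * x"
  by (simp add: dual_scale_def vir_dual_const_def vir_scale_def dual_eq_iff)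

lemma map_poly_dual_scale: "map_poly (dual_scale vir_scale r) p = smult (vir_dual_const r) p"
  by (intro poly_eqI) (simp add: coeff_map_poly dual_scale_vir)

lemma map_poly_vir_derivation_poly:
  assumes "vir_derivation D"
  shows "poly (map_poly D p) (vir_const t) = D (poly p (vir_const t))"
proof -
  interpret vir_derivation D by fact
  show ?thesis
    by (induction p) (simp_all add: zero add const_mult map_poly_additive_pCons additive_axioms)
qed

context virasoro_pva
begin

text \<open>The \<epsilon>-coefficient of the Jacobi identity, that is, the 2-cocycle condition on
  \<open>Z\<close>.\<close>

definition linearized_jacobi :: "('a vir \<Rightarrow> 'a vir \<Rightarrow> 'a vir poly) \<Rightarrow> bool" where
  "linearized_jacobi Z \<longleftrightarrow>
     (\<forall>s t a b c. vir_jac_mixed W Z s t a b c + vir_jac_mixed Z W s t a b c = 0)"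

text \<open>The \<epsilon>-parts of the arguments contribute instances of the Jacobi identity of
  \<open>W\<close>, so only their standard parts remain.\<close>

lemma eval2_dual_jacobiator:
  assumes "vir_skew Z"
  shows "eval2 (Dual (vir_const s) 0) (Dual (vir_const t) 0)
      (pva_jacobiator (dual_br W Z) x y z) =
    Dual 0 (vir_jac_mixed W Z s t (std x) (std y) (std z) +
      vir_jac_mixed Z W s t (std x) (std y) (std z))"
proof -
  interpret Z: vir_skew Z by fact
  have const: "bracket_constant (dual_br W Z) (Dual (vir_const k) 0)" for k
    unfolding bracket_constant_def dual_poly_eq_iff
    by (simp add: map_poly_dual_br const_left const_right Z.const_left Z.const_right
        smult_add_right)
  have add: "additive (dual_br W Z a)" "additive (\<lambda>b. dual_br W Z b a)" for a
    by (rule additiveI; simp add: dual_poly_eq_iff map_poly_dual_br add_left add_right Z.add_left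
        Z.add_right)+
  have ev: "poly (dual_br W Z a b) (Dual (vir_const k) 0) =
      Dual (vir_ev W k (std a) (std b))
        (vir_ev Z k (std a) (std b) + vir_ev W k (eps a) (std b) + vir_ev W k (std a) (eps b))"
    for a b k
    by (simp add: poly_Dual map_poly_dual_br vir_ev_def)
  have st: "Dual (vir_const s) 0 + Dual (vir_const t) 0 = Dual (vir_const (s + t)) 0"
    by (simp add: dual_eq_iff vir_const_add)
  have J: "vir_ev W s a (vir_ev W t b c) =
      vir_ev W t b (vir_ev W s a c) + vir_ev W (s + t) (vir_ev W s a b) c" for a b c
    using jac[of s t a b c] by (simp add: vir_jacobiator_def algebra_simps)
  show ?thesis
    unfolding eval2_pva_jacobiator[OF add const const] st ev dual_eq_iff
    by (simp add: vir_jac_mixed_def ev_add_left ev_add_right J)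
qed

text \<open>The axioms are evaluated on elements without \<epsilon>-part and their
  \<epsilon>-components are read off.\<close>

lemma first_order_deformationD:
  assumes "first_order_deformation vir_scale vir_der W Z"
  shows "vir_skew Z" "linearized_jacobi Z"
proof -
  interpret P: pva "dual_scale vir_scale" "dual_der vir_der" "dual_br W Z"
    using assms by (simp add: first_order_deformation_def)
  note parts = dual_poly_eq_iff map_poly_dual_br map_poly_dual_der[OF der_additive]
    map_poly_dual_subst_skew[OF der_additive]
  have leibniz: "Z a (b * c) = smult c (Z a b) + smult b (Z a c)" for a b c
    using P.leibniz[of "Dual a 0" "Dual b 0" "Dual c 0"]
    by (simp add: parts zero_left zero_right)
  have "Z a 1 = 0" for a using leibniz[of a 1 1] by simp
  moreover have "Z a (vir_const k * b) = smult (vir_const k) (Z a b)" for a b k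
    using P.br_scale_right[of "Dual a 0" "Dual k 0" "Dual b 0"]
    unfolding map_poly_dual_scale
    by (simp add: parts dual_scale_vir vir_dual_const_def zero_left zero_right)
  ultimately show Z: "vir_skew Z"
  proof (unfold_locales, goal_cases)
    case (1 a b c)
    then show ?case
      using P.br_add_right[of "Dual a 0" "Dual b 0" "Dual c 0"]
      by (simp add: parts zero_left zero_right)
  next
    case (3 a b)
    then show ?case
      using P.sesquilinear_right[of "Dual a 0" "Dual b 0"]
      by (simp add: parts zero_left zero_right theta_def dual_der_def der.zero)
  next
    case (5 a b)
    then show ?case
      using P.skew_symmetry[of "Dual a 0" "Dual b 0"]
      by (simp add: parts zero_left zero_right)
  qed (use leibniz in blast)+
  have "pva_jacobiator (dual_br W Z) x y z = 0" for x y z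
    using P.jacobi[of x y z] by (simp add: pva_jacobiator_def)
  then have "vir_jac_mixed W Z s t a b c + vir_jac_mixed Z W s t a b c = 0" for s t a b c
    using eval2_dual_jacobiator[OF Z, of s t "Dual a 0" "Dual b 0" "Dual c 0"]
    by (simp add: eval2_def zero_dual_def)
  then show "linearized_jacobi Z" by (simp add: linearized_jacobi_def)
qed

lemma first_order_deformationI:
  assumes "vir_skew Z" "linearized_jacobi Z"
  shows "first_order_deformation vir_scale vir_der W Z"
  unfolding first_order_deformation_def
proof -
  interpret Z: vir_skew Z by fact
  note parts = dual_poly_eq_iff map_poly_dual_br map_poly_dual_der[OF der_additive]
    map_poly_dual_subst_skew[OF der_additive]
  have J: "pva_jacobiator (dual_br W Z) x y z = 0" for x y z
  \<comment> \<open>Constants without \<epsilon>-part suffice as test points: both components of a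
    polynomial vanishing there are polynomials over a domain that vanish at all field
    constants.\<close>
  proof (rule eval2_eq_0D[of "range (\<lambda>s. Dual (vir_const s) 0)"])
    show "p = 0" if "\<And>x. x \<in> range (\<lambda>s. Dual (vir_const s) 0) \<Longrightarrow> poly p x = 0"
      for p :: "'a vir dual poly"
    proof -
      have "Dual (poly (map_poly std p) (vir_const s)) (poly (map_poly eps p) (vir_const s)) = 0" for s
        using that by (simp flip: poly_Dual)
      then have "map_poly std p = 0" "map_poly eps p = 0"
        by (auto intro!: vir_const_poly_eqI simp: zero_dual_def)
      then show ?thesis by (simp add: dual_poly_eq_iff)
    qed
  qed (use assms(2) in \<open>auto simp: eval2_dual_jacobiator[OF assms(1)] linearized_jacobi_def
      zero_dual_def\<close>)
  have mod: "module (dual_scale (vir_scale :: 'a \<Rightarrow> _))"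
    by unfold_locales
      (simp_all add: dual_scale_vir vir_dual_const_def dual_eq_iff vir_const_add vir_const_mult
        algebra_simps)
  show "pva (dual_scale vir_scale) (dual_der vir_der) (dual_br W Z)"
  proof (intro pva.intro pva_axioms.intro mod)
    show "alg_derivation (dual_scale vir_scale) (dual_der (vir_der :: 'a vir \<Rightarrow> _))"
      unfolding alg_derivation_def
      by (auto intro!: module_hom.intro module_hom_axioms.intro mod
          simp: dual_scale_vir vir_dual_const_def dual_der_def dual_eq_iff der.add der.mult der.const
            algebra_simps)
    show "dual_br W Z a b = - subst_skew (dual_der vir_der) (dual_br W Z b a)" for a b
      using skew[of "std a" "std b"] Z.skew[of "std a" "std b"] skew[of "std a" "eps b"]
        skew[of "eps a" "std b"]
      by (simp add: parts subst_skew_add der_additive)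
  qed (use J[unfolded pva_jacobiator_def] in \<open>simp_all add: map_poly_dual_scale parts dual_scale_vir
      vir_dual_const_def dual_der_def add_left add_right Z.add_left Z.add_right const_left const_right
      Z.const_left Z.const_right der_left der_right Z.der_left Z.der_right leibniz Z.leibniz theta_def
      vir_const_right Z.vir_const_right map_poly_add der_additive smult_add_right smult_add_left
      mult.assoc add_ac\<close>)
qed

text \<open>The \<epsilon>-component of the intertwining relation reads
  \<open>Z(a, b) + D W(a, b) = Z'(a, b) + W(D a, b) + W(a, D b)\<close>.\<close>

lemma equivalent_deformationsI:
  assumes D: "vir_derivation D" "\<And>f. D (vir_der f) = vir_der (D f)"
    and Z: "\<And>a b. Z a b = Z' a b + bracket_coboundary W D a b"
  shows "equivalent_deformations vir_scale vir_der W Z Z'"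
proof -
  interpret D: vir_derivation D by fact
  have "map_poly std (map_poly (id_plus_eps D) p) = map_poly std p"
    "map_poly eps (map_poly (id_plus_eps D) p) = map_poly eps p + map_poly D (map_poly std p)" for p
    by (intro poly_eqI; simp add: coeff_map_poly id_plus_eps_def D.zero zero_dual_def[symmetric])+
  then have "map_poly (id_plus_eps D) (dual_br W Z x y) =
      dual_br W Z' (id_plus_eps D x) (id_plus_eps D y)" for x y
    by (simp add: dual_poly_eq_iff map_poly_dual_br Z bracket_coboundary_def id_plus_eps_def add_left
        add_right)
  with D show ?thesis
    by (auto simp: equivalent_deformations_def alg_derivation_iff_vir_derivation)
qed

text \<open>All terms regroup into Jacobiators of \<open>W\<close> with \<open>D\<close> applied to
  one argument, minus \<open>D\<close> of the Jacobiator.\<close>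

lemma linearized_jacobi_coboundary:
  assumes "vir_derivation D"
  shows "linearized_jacobi (bracket_coboundary W D)"
proof -
  interpret D: vir_derivation D by fact
  have ev: "vir_ev (bracket_coboundary W D) s a b =
      vir_ev W s (D a) b + vir_ev W s a (D b) - D (vir_ev W s a b)" for s a b
    by (simp add: vir_ev_def bracket_coboundary_def map_poly_vir_derivation_poly assms)
  have diff: "vir_ev W s a (b - c) = vir_ev W s a b - vir_ev W s a c" for s a b c
    by (simp add: vir_ev_def diff_right)
  have "vir_jac_mixed W (bracket_coboundary W D) s t a b c +
      vir_jac_mixed (bracket_coboundary W D) W s t a b c =
      vir_jacobiator W s t (D a) b c + vir_jacobiator W s t a (D b) c +
      vir_jacobiator W s t a b (D c) - D (vir_jacobiator W s t a b c)" for s t a b c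
    unfolding vir_jac_mixed_def ev vir_jacobiator_def
    by (simp add: ev_add_left ev_add_right ev_diff_left diff D.diff)
  then show ?thesis by (simp add: linearized_jacobi_def jac D.zero)
qed

lemma linearized_jacobi_diff:
  assumes "vir_skew Z" "vir_skew Z'" "linearized_jacobi Z" "linearized_jacobi Z'"
  shows "linearized_jacobi (\<lambda>a b. Z a b - Z' a b)"
proof -
  interpret Z: vir_skew Z by fact
  interpret Z': vir_skew Z' by fact
  have ev: "vir_ev (\<lambda>a b. Z a b - Z' a b) s a b = vir_ev Z s a b - vir_ev Z' s a b" for s a b
    by (simp add: vir_ev_def)
  have diff: "vir_ev W s a (b - c) = vir_ev W s a b - vir_ev W s a c" for s a b c
    by (simp add: vir_ev_def diff_right)
  have "vir_jac_mixed W (\<lambda>a b. Z a b - Z' a b) s t a b c =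
      vir_jac_mixed W Z s t a b c - vir_jac_mixed W Z' s t a b c"
    "vir_jac_mixed (\<lambda>a b. Z a b - Z' a b) W s t a b c =
      vir_jac_mixed Z W s t a b c - vir_jac_mixed Z' W s t a b c" for s t a b c
    by (simp_all add: vir_jac_mixed_def ev ev_diff_left diff)
  then show ?thesis
    using assms(3,4) by (simp add: linearized_jacobi_def flip: add_diff_add)
qed

section \<open>Modes of a cocycle at \<open>L\<close>\<close>

lemma linearized_jacobi_coeff:
  assumes "vir_skew Z" "linearized_jacobi Z"
  shows "coeff (vir_jac_poly W Z t a b c) n + coeff (vir_jac_poly Z W t a b c) n = 0"
proof -
  have "vir_jac_poly W Z t a b c + vir_jac_poly Z W t a b c = 0"
    by (rule vir_const_poly_eqI)
      (use assms in \<open>simp add: poly_vir_jac_poly vir_skew_axioms linearized_jacobi_def\<close>)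
  then show ?thesis by (simp flip: coeff_add)
qed

lemma vir_derivation_coeff:
  assumes "vir_skew Z"
  shows "vir_derivation (\<lambda>b. coeff (Z a b) n)"
proof -
  interpret Z: vir_skew Z by fact
  show ?thesis
    by (rule vir_derivationI)
      (simp_all add: Z.add_right Z.leibniz Z.vir_const_right mult.commute add.commute)
qed

text \<open>In mode 0 the bracket with \<open>L\<close> is \<open>\<partial>\<close>, and its terms
  cancel by sesquilinearity of \<open>Z\<close>.\<close>

lemma cocycle_coeff_0_derivation:
  assumes Z: "vir_skew Z" "linearized_jacobi Z"
  defines "d \<equiv> \<lambda>b. coeff (Z (vir_L 0) b) 0"
  shows "map_poly d (W b c) = W (d b) c + W b (d c)"
proof (rule vir_const_poly_eqI)
  interpret Z: vir_skew Z by fact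
  fix t
  have d: "vir_derivation d" unfolding d_def by (rule vir_derivation_coeff) fact
  have "d (vir_ev W t b c) = vir_ev W t (d b) c + vir_ev W t b (d c)"
    using linearized_jacobi_coeff[OF Z, of t "vir_L 0" b c 0]
    by (simp add: coeff_vir_jac_poly vir_skew_axioms Z(1) ad_L[unfolded ad_def] Z.ev_der_right
        Z.ev_der_left algebra_simps d_def)
  then show "poly (map_poly d (W b c)) (vir_const t) = poly (W (d b) c + W b (d c)) (vir_const t)"
    by (simp add: map_poly_vir_derivation_poly d vir_ev_def)
qed

text \<open>A contracting homotopy: mode 1 of \<open>W\<close> at \<open>L\<close> is the weight
  operator, while mode 1 of \<open>Z\<close> enters as a coboundary. The number 3 is the weight
  \<open>2 + 2 - 1\<close> of the bracket of \<open>L\<close> with itself, \<open>\<lambda>\<close>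
  having weight 1.\<close>

lemma cocycle_coeff_1:
  assumes Z: "vir_skew Z" "linearized_jacobi Z"
    and d: "\<And>b. coeff (Z (vir_L 0) b) 0 = 0"
  defines "e \<equiv> \<lambda>b. coeff (Z (vir_L 0) b) 1"
  shows "vir_wt (coeff (Z (vir_L 0) (vir_L 0)) n) + (of_nat n - 3) * coeff (Z (vir_L 0) (vir_L 0)) n =
    coeff (bracket_coboundary W e (vir_L 0) (vir_L 0)) n"
proof -
  interpret Z: vir_skew Z by fact
  have e: "vir_derivation e" unfolding e_def by (rule vir_derivation_coeff) fact
  define z where "z = Z (vir_L 0) (vir_L 0)"
  have two: "Z a (2 * b) = smult 2 (Z a b)" "Z (2 * a) b = smult 2 (Z a b)" for a b
    using Z.const_right[of a 2 b] Z.const_left[of 2 a b] by (simp_all add: vir_const_numeral)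
  have "map_poly vir_wt z + pCons 0 (pderiv z) - smult 3 z =
      bracket_coboundary W e (vir_L 0) (vir_L 0)"
  proof (rule vir_const_poly_eqI)
    fix t
    have "vir_wt (poly z (vir_const t)) - 4 * poly z (vir_const t)
        + (poly z (vir_const t) + vir_const t * poly (pderiv z) (vir_const t)) =
        vir_ev W t (vir_L 0) (e (vir_L 0)) + vir_ev W t (e (vir_L 0)) (vir_L 0)
        - e (vir_ev W t (vir_L 0) (vir_L 0))"
      using linearized_jacobi_coeff[OF Z, of t "vir_L 0" "vir_L 0" "vir_L 0" 1]
      unfolding coeff_vir_jac_poly(2)[OF vir_skew_axioms] coeff_vir_jac_poly(2)[OF Z(1)] coeff_1_L
      by (simp add: ad_L[unfolded ad_def] d zero_left e_def vir_wt_L Z.der_left pderiv_minus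
          pderiv_pCons two vir_ev_def z_def) (simp add: algebra_simps)
    then show "poly (map_poly vir_wt z + pCons 0 (pderiv z) - smult 3 z) (vir_const t) =
        poly (bracket_coboundary W e (vir_L 0) (vir_L 0)) (vir_const t)"
      by (simp add: bracket_coboundary_def map_poly_vir_derivation_poly e wt.vir_derivation_axioms
          vir_ev_def algebra_simps)
  qed
  from arg_cong[OF this, of "\<lambda>p. coeff p n"] show ?thesis
    by (cases n)
      (simp_all add: z_def coeff_map_poly_additive wt.additive_axioms coeff_pderiv algebra_simps)
qed

lemma wt_coeff:
  "vir_wt (coeff (W b c) n) =
    coeff (W (vir_wt b) c) n + coeff (W b (vir_wt c)) n - of_nat (Suc n) * coeff (W b c) n"
proof -
  have "map_poly vir_wt (W b c) =
      W (vir_wt b) c + W b (vir_wt c) - (W b c + pCons 0 (pderiv (W b c)))"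
    by (rule vir_const_poly_eqI)
      (simp add: map_poly_vir_derivation_poly wt.vir_derivation_axioms wt_ev[unfolded vir_ev_def])
  from arg_cong[OF this, of "\<lambda>p. coeff p n"] show ?thesis
    by (cases n)
      (simp_all add: coeff_map_poly_additive wt.additive_axioms coeff_pderiv algebra_simps)
qed

text \<open>As \<open>W\<close> is homogeneous, the weight operator acts on coboundaries through its
  commutator with \<open>D\<close>.\<close>

lemma wt_coboundary:
  assumes D: "vir_derivation D"
  defines "E \<equiv> \<lambda>f. vir_wt (D f) - D (vir_wt f)"
  shows "vir_wt (coeff (bracket_coboundary W D (vir_L 0) (vir_L 0)) n)
      + (of_nat n - 3) * coeff (bracket_coboundary W D (vir_L 0) (vir_L 0)) n =
    coeff (bracket_coboundary W E (vir_L 0) (vir_L 0)) n"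
proof -
  interpret D: vir_derivation D by fact
  have E: "vir_derivation E"
    unfolding E_def by (rule vir_derivation_commutator[OF wt.vir_derivation_axioms D])
  interpret E: vir_derivation E by fact
  have L2: "vir_wt (vir_L 0) = vir_const 2 * vir_L 0" by (simp add: vir_wt_L vir_const_numeral)
  define x where "x = coeff (W (vir_L 0) (vir_L 0)) n"
  have x: "vir_wt x = vir_const (3 - of_nat n) * x"
    using wt_coeff[of "vir_L 0" "vir_L 0" n]
    by (simp add: L2 const_left const_right x_def)
      (simp add: vir_const_diff vir_const_of_nat vir_const_numeral algebra_simps)
  have "vir_wt (D x) = vir_const (3 - of_nat n) * D x + E x"
    by (simp add: E_def x D.const_mult)
  moreover have "E (vir_L 0) = vir_wt (D (vir_L 0)) - vir_const 2 * D (vir_L 0)"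
    by (simp add: E_def L2 D.const_mult)
  ultimately show ?thesis
    by (simp add: bracket_coboundary_def coeff_map_poly_additive D.additive_axioms E.additive_axioms
        wt.add wt.diff wt_coeff L2 const_left const_right diff_left diff_right flip: x_def)
      (simp add: vir_const_diff vir_const_of_nat vir_const_numeral algebra_simps)
qed

text \<open>The two slots contribute \<open>2j\<close> times the bracket. \<open>D\<close> then
  subtracts \<open>j (L' + 2\<lambda>L)\<close> but kills the central term, which leaves
  \<open>2\<kappa>\<close> there.\<close>

lemma coboundary_L:
  assumes D: "vir_derivation D" "\<And>f. D (vir_der f) = vir_der (D f)"
    and DL: "D (vir_L 0) = vir_const j * vir_L 0"
  shows "bracket_coboundary W D (vir_L 0) (vir_L 0) =
    smult (vir_const j) [:vir_L 1, 2 * vir_L 0, 0, vir_const (2 * \<kappa>):]"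
proof -
  interpret D: vir_derivation D by fact
  have "D (vir_L 1) = vir_const j * vir_L 1"
    using D(2)[of "vir_L 0"] by (simp add: DL vir_der_L der.const_mult)
  moreover have "D (2 * vir_L 0) = 2 * (vir_const j * vir_L 0)"
    using D.const_mult[of 2 "vir_L 0"] by (simp add: vir_const_numeral DL)
  ultimately show ?thesis
    by (simp add: bracket_coboundary_def DL const_left const_right LL virasoro_op_def
        map_poly_additive_pCons D.additive_axioms D.const D.zero)
      (simp add: vir_const_mult vir_const_numeral algebra_simps)
qed

lemma coboundary_add:
  assumes "vir_derivation D" "vir_derivation E"
  shows "bracket_coboundary W (\<lambda>f. D f + E f) a b =
    bracket_coboundary W D a b + bracket_coboundary W E a b"
    and "bracket_coboundary W (\<lambda>f. D f - E f) a b =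
    bracket_coboundary W D a b - bracket_coboundary W E a b"
proof -
  interpret D: vir_derivation D by fact
  interpret E: vir_derivation E by fact
  have "map_poly (\<lambda>f. D f + E f) p = map_poly D p + map_poly E p"
    "map_poly (\<lambda>f. D f - E f) p = map_poly D p - map_poly E p" for p
    by (intro poly_eqI; simp add: coeff_map_poly D.zero E.zero)+
  then show "bracket_coboundary W (\<lambda>f. D f + E f) a b =
    bracket_coboundary W D a b + bracket_coboundary W E a b"
    and "bracket_coboundary W (\<lambda>f. D f - E f) a b =
    bracket_coboundary W D a b - bracket_coboundary W E a b"
    by (simp_all add: bracket_coboundary_def add_left add_right diff_left diff_right)
qed

text \<open>With \<open>\<lambda>\<close> of weight 1 only \<open>L'\<close>,
  \<open>\<lambda>L\<close> and \<open>\<lambda>^3\<close> have total weight 3; a coefficient of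
  \<open>\<lambda>^2\<close> would have weight 1.\<close>

lemma weight_3_poly:
  assumes w: "\<And>n m. conf_weight m + n \<noteq> 3 \<Longrightarrow> mlookup (coeff w n) m = 0"
  obtains \<alpha> \<beta> \<gamma> where
    "w = [:vir_const \<alpha> * vir_L 1, vir_const \<beta> * vir_L 0, 0, vir_const (\<gamma> :: 'a):]"
proof -
  define \<alpha> \<beta> \<gamma> where "\<alpha> = mlookup (coeff w 0) (msingle 1 1)"
    and "\<beta> = mlookup (coeff w 1) (msingle 0 1)" and "\<gamma> = mlookup (coeff w 3) 0"
  have c0: "coeff w 0 = vir_const \<alpha> * vir_L 1"
  proof (intro poly_mapping_eqI)
    fix m
    show "mlookup (coeff w 0) m = mlookup (vir_const \<alpha> * vir_L 1) m"
      using w[of m 0] conf_weight_small(4)[of m]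
      by (cases "m = msingle 1 1") (auto simp: \<alpha>_def lookup_vir_const_mult vir_L_def lookup_single)
  qed
  have c1: "coeff w 1 = vir_const \<beta> * vir_L 0"
  proof (intro poly_mapping_eqI)
    fix m
    show "mlookup (coeff w 1) m = mlookup (vir_const \<beta> * vir_L 0) m"
      using w[of m 1] conf_weight_small(3)[of m]
      by (cases "m = msingle 0 1") (auto simp: \<beta>_def lookup_vir_const_mult vir_L_def lookup_single)
  qed
  have c2: "coeff w 2 = 0"
  proof (intro poly_mapping_eqI)
    fix m
    show "mlookup (coeff w 2) m = mlookup 0 m"
      using w[of m 2] conf_weight_small(1)[of m] by auto
  qed
  have c3: "coeff w 3 = vir_const \<gamma>"
  proof (intro poly_mapping_eqI)
    fix m
    show "mlookup (coeff w 3) m = mlookup (vir_const \<gamma>) m"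
      using w[of m 3] conf_weight_small(2)[of m]
      by (cases "m = 0") (auto simp: \<gamma>_def vir_const_def lookup_single)
  qed
  have c4: "coeff w (n + 4) = 0" for n
    by (intro poly_mapping_eqI) (use w[of _ "n + 4"] in simp)
  have "w = [:vir_const \<alpha> * vir_L 1, vir_const \<beta> * vir_L 0, 0, vir_const \<gamma>:]"
  proof (intro poly_eqI)
    fix n
    show "coeff w n =
        coeff [:vir_const \<alpha> * vir_L 1, vir_const \<beta> * vir_L 0, 0, vir_const \<gamma>:] n"
    proof (cases "n < 4")
      case True
      then have "n = 0 \<or> n = 1 \<or> n = 2 \<or> n = 3" by linarith
      then show ?thesis
        using c0 c1 c2 c3 by (auto simp: numeral_2_eq_2 numeral_3_eq_3)
    next
      case False
      then obtain k where "n = k + 4" by (metis add.commute le_Suc_ex not_less)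
      then show ?thesis using c4[of k] by (simp add: coeff_eq_0)
    qed
  qed
  then show thesis by (rule that)
qed

text \<open>Three coboundaries are split off: \<open>D1\<close> removes mode 0, \<open>D2\<close>
  the parts of total weight other than 3, and \<open>D3\<close> the combination
  \<open>L' + 2\<lambda>L\<close>.\<close>

lemma cocycle_normal_form:
  assumes Z: "vir_skew Z" "linearized_jacobi Z"
  obtains k D where "vir_derivation D" "\<And>f. D (vir_der f) = vir_der (D f)"
    "Z (vir_L 0) (vir_L 0) =
      monom (vir_const k) 3 + bracket_coboundary W D (vir_L 0) (vir_L 0)"
proof -
  let ?L = "vir_L 0 :: 'a vir"
  define d where "d b = coeff (Z ?L b) 0" for b
  have coeff_0_der: "coeff (X a (vir_der b)) 0 = vir_der (coeff (X a b) 0)"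
    if "vir_skew X" for X :: "'a vir \<Rightarrow> 'a vir \<Rightarrow> 'a vir poly" and a b
    by (simp add: vir_skew.der_right[OF that] coeff_theta der_additive)
  have "\<exists>h. \<forall>b. d b = ad h b"
  proof (rule derivation_inner)
    show "vir_derivation d" unfolding d_def[abs_def] by (rule vir_derivation_coeff[OF Z(1)])
    show "d (vir_der f) = vir_der (d f)" for f by (simp add: d_def coeff_0_der Z(1))
    show "map_poly d (W ?L b) = W (d ?L) b + W ?L (d b)" for b
      unfolding d_def[abs_def] by (rule cocycle_coeff_0_derivation[OF Z])
  qed
  then obtain h where h: "\<And>b. d b = ad h b" by blast
  \<comment> \<open>At \<open>\<lambda> = 0\<close> the coboundary of this field on
    \<open>(L, L)\<close> is \<open>ad h L + \<partial>h - \<partial>h\<close>, which equals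
    \<open>d L\<close>.\<close>
  define D1 where "D1 = vir_evo_field h"
  have D1: "vir_derivation D1" "D1 (vir_der f) = vir_der (D1 f)" "D1 ?L = h" for f
    by (simp_all add: D1_def vir_derivation_evo_field vir_evo_field_der vir_evo_field_L)
  note cob1 = vir_skew_coboundary[OF vir_skew_axioms D1(1,2)]
  define Z1 where "Z1 a b = Z a b - bracket_coboundary W D1 a b" for a b
  have Z1: "vir_skew Z1" "linearized_jacobi Z1"
    unfolding Z1_def[abs_def]
    using vir_skew_add[OF Z(1) vir_skew_smult[OF cob1, of "-1"]]
      linearized_jacobi_diff[OF Z(1) cob1 Z(2) linearized_jacobi_coboundary[OF D1(1)]]
    by (simp_all add: vir_const_minus)
  have "coeff (Z1 ?L ?L) 0 = 0"
    using h[of ?L] D1(2)[of ?L] ad_L[of h]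
    by (simp add: Z1_def bracket_coboundary_def coeff_map_poly_additive D1
        vir_derivation.axioms(1)[OF D1(1), THEN derivation.axioms(1)] coeff_LL[simplified] vir_der_L
        d_def ad_def)
  moreover have "vir_derivation (\<lambda>f :: 'a vir. 0 :: 'a vir)" by (rule vir_derivationI) simp_all
  ultimately have d1: "coeff (Z1 ?L b) 0 = 0" for b
    using vir_derivation_evolutionary_eqI[OF vir_derivation_coeff[OF Z1(1)] coeff_0_der[OF Z1(1)],
        of "\<lambda>_. 0" ?L b] by (simp add: der.zero)
  define e where "e b = coeff (Z1 ?L b) 1" for b
  have e: "vir_derivation e" unfolding e_def[abs_def] by (rule vir_derivation_coeff[OF Z1(1)])
  \<comment> \<open>Mode 1 commutes with \<open>\<partial>\<close> only because mode 0 has been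
    removed.\<close>
  have e_der: "e (vir_der f) = vir_der (e f)" for f
    by (simp add: e_def vir_skew.der_right[OF Z1(1)] coeff_theta der_additive d1)
  \<comment> \<open>Solves \<open>vir_wt s - 2 s = e L\<close> except along \<open>L\<close>, where
    \<open>inverse 0 = 0\<close>; the component left over is \<open>j\<close>.\<close>
  define s where "s = vir_diag (\<lambda>m. inverse (of_nat (conf_weight m) - 2)) (e ?L)"
  define j where "j = mlookup (e ?L) (msingle 0 1)"
  have s: "e ?L - (vir_wt s - 2 * s) = vir_const j * ?L"
  proof (intro poly_mapping_eqI)
    fix m
    have two: "mlookup (2 * s) m = 2 * mlookup s m"
      using lookup_vir_const_mult[of 2 s m] by (simp add: vir_const_numeral)
    have "of_nat (conf_weight m) = (2::'a) \<longleftrightarrow> m = msingle 0 1"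
      using of_nat_eq_iff[of "conf_weight m" 2, where 'a = 'a] conf_weight_small(3)[of m] by simp
    then have "x - (of_nat (conf_weight m) - 2) * (inverse (of_nat (conf_weight m) - 2) * x) =
        (if m = msingle 0 1 then x else 0)" for x :: 'a
      by auto
    then have "mlookup (e ?L) m - (of_nat (conf_weight m) - 2) * mlookup s m =
        (if m = msingle 0 1 then j else 0)"
      unfolding s_def lookup_vir_diag j_def by auto
    moreover have "mlookup (vir_const j * ?L) m = (if m = msingle 0 1 then j else 0)"
      by (simp add: lookup_vir_const_mult vir_L_def lookup_single)
    ultimately show "mlookup (e ?L - (vir_wt s - 2 * s)) m = mlookup (vir_const j * ?L) m"
      by (simp only: lookup_minus lookup_vir_wt two left_diff_distrib)
  qed
  define D2 where "D2 = vir_evo_field s"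
  have D2: "vir_derivation D2" "D2 (vir_der f) = vir_der (D2 f)" "D2 ?L = s" for f
    by (simp_all add: D2_def vir_derivation_evo_field vir_evo_field_der vir_evo_field_L)
  interpret D2: vir_derivation D2 by (rule D2)
  note cob2 = vir_skew_coboundary[OF vir_skew_axioms D2(1,2)]
  define E where "E f = vir_wt (D2 f) - D2 (vir_wt f)" for f
  have E: "vir_derivation E"
    unfolding E_def[abs_def] by (rule vir_derivation_commutator[OF wt.vir_derivation_axioms D2(1)])
  have wt_der: "vir_wt (vir_der f) = vir_der f + vir_der (vir_wt f)" for f :: "'a vir"
    using der_right[of ?L f] coeff_1_L[of "vir_der f"] coeff_1_L[of f] ad_L[of f]
    by (simp add: coeff_theta der_additive ad_def)
  define w where "w = Z1 ?L ?L - bracket_coboundary W D2 ?L ?L"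
  have eE: "vir_derivation (\<lambda>f. e f - E f)" by (rule vir_derivation_add(2)[OF e E])
  \<comment> \<open>By the choice of \<open>s\<close>, the derivation \<open>e - E\<close> merely
    rescales \<open>L\<close> by \<open>j\<close>.\<close>
  have cob3: "bracket_coboundary W (\<lambda>f. e f - E f) ?L ?L =
      smult (vir_const j) [:vir_L 1, 2 * ?L, 0, vir_const (2 * \<kappa>):]"
  proof (rule coboundary_L[OF eE])
    show "e (vir_der f) - E (vir_der f) = vir_der (e f - E f)" for f
      by (simp add: e_der E_def D2(2) wt_der D2.add der.diff)
    have "E ?L = vir_wt s - 2 * s"
      using D2.const_mult[of 2 ?L] by (simp add: E_def D2(3) vir_wt_L vir_const_numeral)
    then show "e ?L - E ?L = vir_const j * ?L" using s by simp
  qed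
  have wt_w: "vir_wt (coeff w n) + (of_nat n - 3) * coeff w n =
      coeff (smult (vir_const j) [:vir_L 1, 2 * ?L, 0, vir_const (2 * \<kappa>):]) n" for n
  proof -
    have 1: "vir_wt (coeff (Z1 ?L ?L) n) + (of_nat n - 3) * coeff (Z1 ?L ?L) n =
        coeff (bracket_coboundary W e ?L ?L) n"
      unfolding e_def[abs_def] by (rule cocycle_coeff_1[OF Z1 d1])
    have 2: "vir_wt (coeff (bracket_coboundary W D2 ?L ?L) n) +
        (of_nat n - 3) * coeff (bracket_coboundary W D2 ?L ?L) n =
        coeff (bracket_coboundary W E ?L ?L) n"
      unfolding E_def[abs_def] by (rule wt_coboundary[OF D2(1)])
    show ?thesis
      unfolding cob3[symmetric] coboundary_add(2)[OF e E] w_def coeff_diff wt.diff 1[symmetric]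
        2[symmetric]
      by (simp add: algebra_simps)
  qed
  have lookup_w: "(of_nat (conf_weight m + n) - 3) * mlookup (coeff w n) m =
      mlookup (coeff (smult (vir_const j) [:vir_L 1, 2 * ?L, 0, vir_const (2 * \<kappa>):]) n) m" for m n
  proof -
    have "(of_nat n - 3) * coeff w n = vir_const (of_nat n - 3) * coeff w n"
      by (simp add: vir_const_diff vir_const_of_nat vir_const_numeral)
    then have "mlookup (vir_wt (coeff w n) + (of_nat n - 3) * coeff w n) m =
        of_nat (conf_weight m) * mlookup (coeff w n) m + (of_nat n - 3) * mlookup (coeff w n) m"
      by (simp only: lookup_add lookup_vir_wt lookup_vir_const_mult)
    then show ?thesis
      unfolding wt_w[symmetric] by (simp add: algebra_simps)
  qed
  \<comment> \<open>A resonance: for the monomial \<open>L'\<close> at \<open>n = 0\<close> the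
    factor on the left is \<open>3 - 3\<close>, while the right side is \<open>j\<close>.\<close>
  have "j = 0"
    using lookup_w[of "msingle 1 1" 0]
    by (simp add: mon_weight_single lookup_vir_const_mult vir_L_def)
  have "mlookup (coeff w n) m = 0" if "conf_weight m + n \<noteq> 3" for n m
  proof -
    have "(of_nat (conf_weight m + n) - of_nat 3) * mlookup (coeff w n) m = 0"
      using lookup_w[of m n] \<open>j = 0\<close> by simp
    then show ?thesis using that unfolding mult_eq_0_iff right_minus_eq of_nat_eq_iff by simp
  qed
  then obtain \<alpha> \<beta> \<gamma> where w: "w = [:vir_const \<alpha> * vir_L 1, vir_const \<beta> * ?L, 0, vir_const \<gamma>:]"
    using weight_3_poly by blast
  have "vir_skew (\<lambda>a b. Z1 a b - bracket_coboundary W D2 a b)"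
    using vir_skew_add[OF Z1(1) vir_skew_smult[OF cob2, of "-1"]]
    by (simp add: vir_const_minus)
  \<comment> \<open>Skew-symmetry ties the coefficients of \<open>L'\<close> and
    \<open>\<lambda>L\<close> together.\<close>
  then have "w = - subst_skew vir_der w"
    unfolding w_def by (rule vir_skew.skew)
  from arg_cong[OF this, of "\<lambda>p. coeff p 0"]
  have "vir_const \<alpha> * vir_L 1 = vir_const \<beta> * vir_L 1 - vir_const \<alpha> * vir_L 1"
    unfolding w
    by (simp add: subst_skew_0 subst_skew_pCons der_additive theta_def map_poly_additive_pCons
        der.const der.zero der.minus der.diff der.const_mult vir_der_L)
  then have "vir_const (2 * \<alpha> - \<beta>) * vir_L 1 = 0"
    by (simp add: vir_const_diff vir_const_mult vir_const_numeral algebra_simps)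
  then have "mlookup (vir_const (2 * \<alpha> - \<beta>) * vir_L 1) (msingle 1 1) = 0"
    by (simp only: lookup_zero)
  then have \<beta>: "\<beta> = 2 * \<alpha>" by (simp add: lookup_vir_const_mult vir_L_def)
  define D3 where "D3 = vir_evo_field (vir_const \<alpha> * ?L)"
  have D3: "vir_derivation D3" "D3 (vir_der f) = vir_der (D3 f)" "D3 ?L = vir_const \<alpha> * ?L" for f
    by (simp_all add: D3_def vir_derivation_evo_field vir_evo_field_der vir_evo_field_L)
  \<comment> \<open>Splitting off the rescaling by \<open>\<alpha>\<close> shifts the coefficient of
    \<open>\<lambda>^3\<close> by \<open>2\<kappa>\<alpha>\<close>.\<close>
  have "w = monom (vir_const (\<gamma> - 2 * \<kappa> * \<alpha>)) 3 + bracket_coboundary W D3 ?L ?L"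
    unfolding coboundary_L[OF D3] w \<beta>
    by (simp add: monom_altdef vir_const_mult vir_const_numeral vir_const_diff algebra_simps numeral_3_eq_3)
  moreover have "Z ?L ?L = w + bracket_coboundary W D1 ?L ?L + bracket_coboundary W D2 ?L ?L"
    by (simp add: w_def Z1_def)
  moreover define D where "D f = D1 f + D2 f + D3 f" for f
  have D12: "vir_derivation (\<lambda>f. D1 f + D2 f)" by (rule vir_derivation_add(1)[OF D1(1) D2(1)])
  ultimately have "Z ?L ?L =
      monom (vir_const (\<gamma> - 2 * \<kappa> * \<alpha>)) 3 + bracket_coboundary W D ?L ?L"
    using coboundary_add(1)[OF D1(1) D2(1), of ?L ?L] coboundary_add(1)[OF D12 D3(1), of ?L ?L]
    by (simp add: D_def[abs_def] algebra_simps)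
  moreover have "vir_derivation D"
    unfolding D_def[abs_def] by (rule vir_derivation_add(1)[OF D12 D3(1)])
  moreover have "D (vir_der f) = vir_der (D f)" for f
    by (simp add: D_def D1(2) D2(2) D3(2) der.add)
  ultimately show thesis using that by blast
qed

end

section \<open>The cubic cocycle and the conclusion\<close>

lemma virasoro_op_add:
  "virasoro_op (\<kappa> + k) = virasoro_op \<kappa> + smult (vir_const k) (monom 1 3)"
  by (simp add: virasoro_op_def vir_const_add smult_monom monom_altdef numeral_3_eq_3)

lemma vir_skew_cube: "vir_skew (vir_op_bracket (monom 1 3))"
proof (rule vir_skew_op_bracket)
  show "subst_skew vir_der (monom 1 3) = - monom (1::'a vir) 3"
    by (simp add: monom_altdef numeral_3_eq_3 subst_skew_0 subst_skew_pCons der_additive theta_def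
        map_poly_additive_pCons der.one der.zero der.minus one_pCons)
qed

lemma vir_op_bracket_smult:
  "vir_op_bracket (smult (vir_const k) H) a b = smult (vir_const k) (vir_op_bracket H a b)"
proof -
  have *: "star vir_der p (smult (vir_const k) q) = smult (vir_const k) (star vir_der p q)" for p q
    by (induction p arbitrary: q) (simp_all add: star_pCons der.theta_smult der.const smult_add_right
        mult.commute)
  show ?thesis by (simp add: vir_op_bracket_def star_smult_left *)
qed

text \<open>The bracket is affine in the central charge and satisfies the Jacobi identity for every
  charge, so the part linear in the variation \<open>k\<close> vanishes by itself.\<close>

lemma linearized_jacobi_cube:
  "virasoro_pva.linearized_jacobi (vir_bracket c) (vir_op_bracket (monom 1 3))"
proof -
  interpret virasoro_pva "vir_bracket c" "c / 12" by (rule virasoro_pva_vir_bracket)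
  let ?W = "vir_bracket c" and ?Y = "vir_op_bracket (monom 1 3) :: 'a vir \<Rightarrow> _"
  interpret Y: vir_skew ?Y by (rule vir_skew_cube)
  have ev: "vir_ev (vir_op_bracket (virasoro_op (c / 12 + k))) s a b =
      vir_ev ?W s a b + vir_const k * vir_ev ?Y s a b" for k s a b
    by (simp add: virasoro_op_add vir_op_bracket_add vir_op_bracket_smult vir_bracket_eq vir_ev_def)
  have J: "vir_const k * (vir_jac_mixed ?W ?Y s t x y z + vir_jac_mixed ?Y ?W s t x y z) +
      vir_const k * (vir_const k * vir_jac_mixed ?Y ?Y s t x y z) = 0" for k s t x y z
  proof -
    have "0 = vir_jacobiator (vir_op_bracket (virasoro_op (c / 12 + k))) s t x y z"
      by (simp add: vir_jacobiator_virasoro)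
    also have "\<dots> = vir_jacobiator ?W s t x y z +
        (vir_const k * (vir_jac_mixed ?W ?Y s t x y z + vir_jac_mixed ?Y ?W s t x y z) +
        vir_const k * (vir_const k * vir_jac_mixed ?Y ?Y s t x y z))"
      unfolding vir_jacobiator_def vir_jac_mixed_def ev
      by (simp add: ev_add_left ev_add_right ev_const_left ev_const_right Y.ev_add_left Y.ev_add_right
          Y.ev_const_left Y.ev_const_right) (simp add: algebra_simps)
    finally show ?thesis by (simp add: jac)
  qed
  have "vir_jac_mixed ?W ?Y s t x y z + vir_jac_mixed ?Y ?W s t x y z = 0" for s t x y z
  proof -
    define P where "P = vir_jac_mixed ?W ?Y s t x y z + vir_jac_mixed ?Y ?W s t x y z"
    define Q where "Q = vir_jac_mixed ?Y ?Y s t x y z"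
    \<comment> \<open>The values \<open>k = 1\<close> and \<open>k = -1\<close> separate the linear
      part from the quadratic one.\<close>
    have "P + Q = 0" "- P + Q = 0"
      using J[of 1 s t x y z] J[of "- 1" s t x y z] by (simp_all add: P_def Q_def vir_const_minus)
    moreover have "2 * P = (P + Q) - (- P + Q)" by simp
    ultimately have "2 * P = 0" by simp
    then have "P = 0" by simp
    then show ?thesis by (simp only: P_def)
  qed
  then show ?thesis by (simp add: linearized_jacobi_def)
qed

theorem corollary4p18:
  fixes c :: "'a::field_char_0"
  shows
    "(\<forall>X. casimir vir_der (vir_bracket c) X \<longrightarrow>
        (\<exists>k::'a. X = loc_func vir_der (vir_scale k 1))) \<and>
     (\<forall>D. pva_derivation vir_scale vir_der (vir_bracket c) D \<longrightarrow>
        inner_derivation (vir_bracket c) D) \<and>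
     (\<exists>Y. first_order_deformation vir_scale vir_der (vir_bracket c) Y \<and>
        Y (vir_L 0) (vir_L 0) = monom 1 3 \<and>
        (\<forall>Z. first_order_deformation vir_scale vir_der (vir_bracket c) Z \<longrightarrow>
           (\<exists>k::'a. equivalent_deformations vir_scale vir_der (vir_bracket c) Z
              (\<lambda>a b. map_poly (vir_scale k) (Y a b)))))"
proof (intro conjI allI impI exI[of _ "vir_op_bracket (monom 1 3)"])
  interpret virasoro_pva "vir_bracket c" "c / 12" by (rule virasoro_pva_vir_bracket)
  let ?Y = "vir_op_bracket (monom 1 3) :: 'a vir \<Rightarrow> _"
  show "\<exists>k. X = loc_func vir_der (vir_scale k 1)" if "casimir vir_der (vir_bracket c) X" for X
    using that by (rule virasoro_casimir)
  show "inner_derivation (vir_bracket c) D"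
    if "pva_derivation vir_scale vir_der (vir_bracket c) D" for D
    using that by (rule virasoro_derivation_inner)
  show "first_order_deformation vir_scale vir_der (vir_bracket c) ?Y"
    by (rule first_order_deformationI) (rule vir_skew_cube linearized_jacobi_cube)+
  show "?Y (vir_L 0) (vir_L 0) = monom 1 3" by (rule vir_op_bracket_L)
  show "\<exists>k. equivalent_deformations vir_scale vir_der (vir_bracket c) Z
      (\<lambda>a b. map_poly (vir_scale k) (?Y a b))"
    if "first_order_deformation vir_scale vir_der (vir_bracket c) Z" for Z
  proof -
    note Z = first_order_deformationD[OF that]
    obtain k D where D: "vir_derivation D" "\<And>f. D (vir_der f) = vir_der (D f)"
      and LL: "Z (vir_L 0) (vir_L 0) =
        monom (vir_const k) 3 + bracket_coboundary (vir_bracket c) D (vir_L 0) (vir_L 0)"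
      using cocycle_normal_form[OF Z] by blast
    \<comment> \<open>Both sides are skew brackets, so agreement on \<open>(L, L)\<close>
      suffices.\<close>
    have "Z a b = map_poly (vir_scale k) (?Y a b) + bracket_coboundary (vir_bracket c) D a b" for a b
      unfolding map_poly_vir_scale
      by (rule vir_skew_eqI[OF Z(1) vir_skew_add[OF vir_skew_smult[OF vir_skew_cube]
            vir_skew_coboundary[OF vir_skew_axioms D]]])
        (simp add: LL vir_op_bracket_L smult_monom)
    with D show ?thesis by (intro exI[of _ k] equivalent_deformationsI)
  qed
qed

end
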